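(* Let $K$ be a field of characteristic zero, $x=(x_1,\dots,x_n)$, and $H\in K[x]^M$ with $\operatorname{trdeg}_K K(H)=M-2$. Let $0\le s<k<M$ and suppose $(H_{s+1},H_{s+2},\dots,H_k)$ has no projective image apex over $K$ in $K^{k-s}$. Suppose additionally that either (i) $(H_{k+1},\dots,H_M)$ has no projective image apex over $K$ in $K^{M-k}$; or (ii) $(H_k,H_{k+1},\dots,H_M)$ has no projective image apex over $K$ in $K^{M-k+1}$ and $H$ has an image apex over $K$ in $K^M$. Let $h=(H_1,\dots,H_s,\,H_{s+1}+H_M,\,H_{s+2},\dots,H_{M-1})\in K[x]^{M-1}$. Then the projective image apices over $K$ in $K^M$ of $H$ are exactly the nonzero vectors in the span of $e_1,\dots,e_s$, and likewise the projective image apices over $K$ in $K^{M-1}$ of $h$ are exactly the nonzero vectors in the span of $e_1,\dots,e_s$. Furthermore, $h$ and $H$ are dB-paired over $K$ (through $B$ with $h=BH$ and $C=I_n$), and every projective image apex of $h$ is inherited from $H$.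
   Context: $e_i$ is the $i$-th standard basis vector. With $y$ a tuple of indeterminates and $t$ a new one: $a\in K^M$ is an image apex of $H$ over $K$ if for all $f\in K[y]$, $f(H)=0\Rightarrow f((1-t)H+ta)=0$; $p\in K^M$ is a projective image apex of $H$ over $K$ if $p\ne0$ and $f(H)=0\Rightarrow f(H+tp)=0$ for all $f\in K[y]$. $\operatorname{trdeg}_K K(H)$ is the transcendence degree over $K$ of the field generated by the components. dB-pairing: $h\in K[x]^m$ and $H\in K[x]^M$ are dB-paired over $K$ through $B\in\operatorname{Mat}_{m,M}(K)$ and $C\in\operatorname{Mat}_{n,n}(K)$ if $h=B\,H(Cx)$ and $\operatorname{trdeg}_K K(h)=\operatorname{trdeg}_K K(H)$. A projective image apex $q$ of $h$ is inherited from $H$ if $q=BQ$ for some projective image apex $Q$ of $H$ over $K$. *)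

theory Defs
  imports "HOL-Library.Poly_Mapping"
begin

type_synonym 'a mpoly = "(nat \<Rightarrow>\<^sub>0 nat) \<Rightarrow>\<^sub>0 'a"

definition mvar :: "nat \<Rightarrow> 'a::comm_ring_1 mpoly" where
  "mvar i = Poly_Mapping.single (Poly_Mapping.single i 1) 1"

definition mconst :: "'a::comm_ring_1 \<Rightarrow> 'a mpoly" where
  "mconst c = Poly_Mapping.single 0 c"

definition vars :: "'a::zero mpoly \<Rightarrow> nat set" where
  "vars p = {i. \<exists>m\<in>Poly_Mapping.keys p. i \<in> Poly_Mapping.keys m}"

definition subst :: "(nat \<Rightarrow> 'a::comm_ring_1 mpoly) \<Rightarrow> 'a mpoly \<Rightarrow> 'a mpoly" where
  "subst g f = (\<Sum>m\<in>Poly_Mapping.keys f. mconst (Poly_Mapping.lookup f m) * (\<Prod>i\<in>Poly_Mapping.keys m. g i ^ Poly_Mapping.lookup m i))"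

text \<open>Tuples of polynomials in K[x] = K[x_1..x_n] are lists whose entries use only the
  variables X_0..X_(n-1); the extra indeterminate t is the variable X_n.
  f ranges over K[y] = K[y_1..y_M], i.e. polynomials in the variables X_0..X_(M-1).\<close>

definition image_apex :: "nat \<Rightarrow> 'a::comm_ring_1 mpoly list \<Rightarrow> 'a list \<Rightarrow> bool" where
  "image_apex n H a \<longleftrightarrow> length a = length H \<and>
     (\<forall>f. vars f \<subseteq> {..<length H} \<longrightarrow> subst (\<lambda>i. H ! i) f = 0 \<longrightarrow>
        subst (\<lambda>i. (1 - mvar n) * H ! i + mvar n * mconst (a ! i)) f = 0)"

definition proj_image_apex :: "nat \<Rightarrow> 'a::comm_ring_1 mpoly list \<Rightarrow> 'a list \<Rightarrow> bool" where
  "proj_image_apex n H p \<longleftrightarrow> length p = length H \<and> p \<noteq> replicate (length H) 0 \<and>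
     (\<forall>f. vars f \<subseteq> {..<length H} \<longrightarrow> subst (\<lambda>i. H ! i) f = 0 \<longrightarrow>
        subst (\<lambda>i. H ! i + mvar n * mconst (p ! i)) f = 0)"

definition alg_indep :: "'a::comm_ring_1 mpoly list \<Rightarrow> bool" where
  "alg_indep G \<longleftrightarrow> (\<forall>f. vars f \<subseteq> {..<length G} \<longrightarrow> subst (\<lambda>i. G ! i) f = 0 \<longrightarrow> f = 0)"

definition trdeg :: "'a::comm_ring_1 mpoly list \<Rightarrow> nat" where
  "trdeg H = Max {card S | S. S \<subseteq> {..<length H} \<and>
                     alg_indep (map (\<lambda>i. H ! i) (sorted_list_of_set S))}"

definition dB_paired :: "nat \<Rightarrow> 'a::comm_ring_1 mpoly list \<Rightarrow> 'a mpoly list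
    \<Rightarrow> (nat \<Rightarrow> nat \<Rightarrow> 'a) \<Rightarrow> (nat \<Rightarrow> nat \<Rightarrow> 'a) \<Rightarrow> bool" where
  "dB_paired n h H B C \<longleftrightarrow>
     (\<forall>i<length h. h ! i = (\<Sum>j<length H. mconst (B i j) *
          subst (\<lambda>l. if l < n then (\<Sum>r<n. mconst (C l r) * mvar r) else mvar l) (H ! j)))
     \<and> trdeg h = trdeg H"

definition id_mat :: "nat \<Rightarrow> nat \<Rightarrow> 'a::comm_ring_1" where
  "id_mat i j = (if i = j then 1 else 0)"

definition mat_vec :: "nat \<Rightarrow> (nat \<Rightarrow> nat \<Rightarrow> 'a::comm_ring_1) \<Rightarrow> 'a list \<Rightarrow> 'a list" where
  "mat_vec m B Q = map (\<lambda>i. \<Sum>j<length Q. B i j * Q ! j) [0..<m]"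

definition span_e_nonzero :: "nat \<Rightarrow> nat \<Rightarrow> 'a::zero list set" where
  "span_e_nonzero M s = {p. length p = M \<and> p \<noteq> replicate M 0 \<and> (\<forall>j. s \<le> j \<and> j < M \<longrightarrow> p ! j = 0)}"

end

theory Submission
  imports Defs "HOL-Computational_Algebra.Fraction_Field" "HOL-Library.Function_Algebras"
    "HOL-Library.FuncSet" "HOL.Vector_Spaces"
begin

text \<open>
  In characteristic zero, \<open>p\<close> is a projective image apex of \<open>H\<close> (or zero) iff some \<open>K\<close>-derivation
  \<open>D\<close> of \<open>K(x)\<close> satisfies \<open>D H\<^sub>i = p\<^sub>i\<close> for all \<open>i\<close>, and an image apex \<open>a\<close> yields an Euler derivation
  \<open>E\<close> with \<open>E H\<^sub>i = a\<^sub>i - H\<^sub>i\<close>. Algebraic independence is linear independence of gradients over \<open>K(x)\<close>.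
  The absence of apices makes \<open>H\<^sub>s\<^sub>+\<^sub>1\<close> algebraic over \<open>K(H\<^sub>s\<^sub>+\<^sub>2, \<dots>, H\<^sub>k)\<close> and \<open>H\<^sub>M\<close> algebraic over the other
  members of its block, so that the remaining \<open>M - 2\<close> components form a transcendence basis of both
  \<open>H\<close> and \<open>h\<close>.

  The crux is an apex \<open>q\<close> of \<open>h\<close>, i.e. a derivation \<open>D\<close> with constant values on this basis and with
  \<open>D H\<^sub>s\<^sub>+\<^sub>1 + D H\<^sub>M\<close> constant. The gradients of \<open>D H\<^sub>s\<^sub>+\<^sub>1\<close> and \<open>D H\<^sub>M\<close> lie in the spans of the gradients of
  the respective blocks, hence in their intersection: this is zero in case (i), and spanned by the
  gradient of \<open>H\<^sub>k\<close> in case (ii), where \<open>E (D H\<^sub>s\<^sub>+\<^sub>1) = 0\<close> (as \<open>D\<close> has degree \<open>-1\<close> for \<open>E\<close>) forces the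
  coefficient to vanish. So \<open>D H\<^sub>s\<^sub>+\<^sub>1\<close> and \<open>D H\<^sub>M\<close> are constants, and \<open>D\<close> restricts to apices of the two
  blocks, which have none.
\<close>

subsection \<open>Polynomials: substitution and partial derivatives\<close>

lemma mconst_add: "mconst (a + b) = mconst a + mconst b"
  by (simp add: mconst_def single_add)

lemma mconst_mult: "mconst (a * b) = mconst a * mconst b"
  by (simp add: mconst_def mult_single)

lemma mconst_0 [simp]: "mconst 0 = 0"
  by (simp add: mconst_def)

lemma mconst_1 [simp]: "mconst 1 = 1"
  by (simp add: mconst_def)

lemma mconst_diff: "mconst (a - b) = mconst a - mconst b"
  by (simp add: mconst_def single_diff)

lemma mconst_eq_0_iff [simp]: "mconst c = 0 \<longleftrightarrow> c = 0"
  by (metis mconst_def lookup_single_eq lookup_zero single_zero)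

lemma sum_single_lookup: "(\<Sum>m\<in>Poly_Mapping.keys f. Poly_Mapping.single m (Poly_Mapping.lookup f m)) = f"
  by (rule poly_mapping_eqI)
    (auto simp: lookup_sum lookup_single when_def in_keys_iff)

lemma mvar_power: "mvar i ^ k = Poly_Mapping.single (Poly_Mapping.single i k) 1"
  by (induction k) (simp_all add: mvar_def mult_single single_add [symmetric])

lemma prod_single_1:
  "(\<Prod>i\<in>I. Poly_Mapping.single (e i) (1 :: 'a::comm_ring_1)) = Poly_Mapping.single (\<Sum>i\<in>I. e i :: nat \<Rightarrow>\<^sub>0 nat) 1"
  by (induction I rule: infinite_finite_induct) (simp_all add: mult_single)

lemma single_eq_mvar_prod:
  "Poly_Mapping.single m c = mconst c * (\<Prod>i\<in>Poly_Mapping.keys m. mvar i ^ Poly_Mapping.lookup m i)"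
  by (simp add: mvar_power prod_single_1 sum_single_lookup mconst_def mult_single)

text \<open>Constants and variables generate the polynomial ring, so an identity between
  constructions compatible with sums and products need only be checked on them.\<close>

lemma mpoly_induct [case_names const var add mult]:
  fixes f :: "'a::comm_ring_1 mpoly"
  assumes const: "\<And>c. P (mconst c)" and var: "\<And>i. P (mvar i)"
    and add: "\<And>f g. P f \<Longrightarrow> P g \<Longrightarrow> P (f + g)"
    and mult: "\<And>f g. P f \<Longrightarrow> P g \<Longrightarrow> P (f * g)"
  shows "P f"
proof -
  have pow: "P (mvar i ^ k)" for i k
    by (induction k) (use const[of 1] var mult in auto)
  have prd: "P (\<Prod>i\<in>I. mvar i ^ e i)" if "finite I" for I and e :: "nat \<Rightarrow> nat"
    using that by induction (use const[of 1] pow mult in auto)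
  have "P (\<Sum>m\<in>M. Poly_Mapping.single m (Poly_Mapping.lookup f m))" if "finite M" for M
    using that
  proof induction
    case empty
    then show ?case using const[of 0] by simp
  next
    case (insert m M)
    then show ?case by (simp add: single_eq_mvar_prod add mult const prd)
  qed
  from this[of "Poly_Mapping.keys f"] show ?thesis
    by (simp add: sum_single_lookup)
qed

section \<open>Substitution as a ring homomorphism\<close>

lemma subst_superset:
  assumes "finite K" "Poly_Mapping.keys f \<subseteq> K"
  shows "subst g f = (\<Sum>m\<in>K. mconst (Poly_Mapping.lookup f m) * (\<Prod>i\<in>Poly_Mapping.keys m. g i ^ Poly_Mapping.lookup m i))"
  unfolding subst_def using assms
  by (intro sum.mono_neutral_left) (auto simp: in_keys_iff)

lemma subst_add: "subst g (f1 + f2) = subst g f1 + subst g f2"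
proof -
  \<comment> \<open>Cancellation may shrink the support of \<open>f1 + f2\<close>, so all three sums
    are taken over the union of the supports.\<close>
  let ?K = "Poly_Mapping.keys f1 \<union> Poly_Mapping.keys f2"
  have "Poly_Mapping.keys (f1 + f2) \<subseteq> ?K" by (rule keys_add)
  then show ?thesis
    by (simp add: subst_superset[of ?K] lookup_add mconst_add distrib_right sum.distrib)
qed

lemma subst_0 [simp]: "subst g 0 = 0"
  by (simp add: subst_def)

lemma subst_sum: "subst g (\<Sum>i\<in>I. F i) = (\<Sum>i\<in>I. subst g (F i))"
  by (induction I rule: infinite_finite_induct) (simp_all add: subst_add)

lemma subst_single:
  "subst g (Poly_Mapping.single m c) = mconst c * (\<Prod>i\<in>Poly_Mapping.keys m. g i ^ Poly_Mapping.lookup m i)"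
  by (simp add: subst_superset[of "{m}"])

lemma prod_keys_superset:
  assumes "finite K" "Poly_Mapping.keys m \<subseteq> K"
  shows "(\<Prod>i\<in>Poly_Mapping.keys m. g i ^ Poly_Mapping.lookup m i) = (\<Prod>i\<in>K. g i ^ Poly_Mapping.lookup m i)"
  using assms by (intro prod.mono_neutral_left) (auto simp: in_keys_iff)

lemma prod_keys_add:
  fixes g :: "nat \<Rightarrow> 'b::comm_ring_1" and m1 m2 :: "nat \<Rightarrow>\<^sub>0 nat"
  shows "(\<Prod>i\<in>Poly_Mapping.keys (m1 + m2). g i ^ Poly_Mapping.lookup (m1 + m2) i) =
    (\<Prod>i\<in>Poly_Mapping.keys m1. g i ^ Poly_Mapping.lookup m1 i) * (\<Prod>i\<in>Poly_Mapping.keys m2. g i ^ Poly_Mapping.lookup m2 i)"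
proof -
  let ?K = "Poly_Mapping.keys m1 \<union> Poly_Mapping.keys m2"
  have "Poly_Mapping.keys (m1 + m2) \<subseteq> ?K" by (rule keys_add)
  then have "(\<Prod>i\<in>Poly_Mapping.keys (m1 + m2). g i ^ Poly_Mapping.lookup (m1 + m2) i) =
      (\<Prod>i\<in>?K. g i ^ Poly_Mapping.lookup (m1 + m2) i)"
    by (intro prod_keys_superset) auto
  also have "\<dots> = (\<Prod>i\<in>?K. g i ^ Poly_Mapping.lookup m1 i) * (\<Prod>i\<in>?K. g i ^ Poly_Mapping.lookup m2 i)"
    by (simp add: lookup_add power_add prod.distrib)
  also have "(\<Prod>i\<in>?K. g i ^ Poly_Mapping.lookup m1 i) = (\<Prod>i\<in>Poly_Mapping.keys m1. g i ^ Poly_Mapping.lookup m1 i)"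
    by (rule prod_keys_superset [symmetric]) auto
  also have "(\<Prod>i\<in>?K. g i ^ Poly_Mapping.lookup m2 i) = (\<Prod>i\<in>Poly_Mapping.keys m2. g i ^ Poly_Mapping.lookup m2 i)"
    by (rule prod_keys_superset [symmetric]) auto
  finally show ?thesis .
qed

lemma subst_mult: "subst g (f1 * f2) = subst g f1 * subst g f2"
proof -
  have *: "subst g (Poly_Mapping.single m1 c1 * Poly_Mapping.single m2 c2) =
    subst g (Poly_Mapping.single m1 c1) * subst g (Poly_Mapping.single m2 c2)" for m1 c1 m2 c2
    by (simp add: mult_single subst_single prod_keys_add mconst_mult)
  let ?s = "\<lambda>f. \<Sum>m\<in>Poly_Mapping.keys f. Poly_Mapping.single m (Poly_Mapping.lookup f m)"
  have "subst g (?s f1 * ?s f2) = subst g (?s f1) * subst g (?s f2)"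
    by (simp only: sum_product subst_sum *)
  then show ?thesis by (simp add: sum_single_lookup)
qed

lemma subst_mconst [simp]: "subst g (mconst c) = mconst c"
  by (simp add: mconst_def subst_single)

lemma subst_1 [simp]: "subst g 1 = 1"
  by (metis mconst_1 subst_mconst)

lemma subst_mvar [simp]: "subst g (mvar i) = g i"
  by (simp add: mvar_def subst_single)

lemma subst_uminus: "subst g (- f) = - subst g f"
  by (metis add.inverse_inverse add_eq_0_iff subst_add subst_0)

lemma subst_diff: "subst g (f1 - f2) = subst g f1 - subst g f2"
  by (metis add_uminus_conv_diff subst_add subst_uminus)

lemma subst_subst: "subst g (subst h f) = subst (\<lambda>i. subst g (h i)) f"
  by (induction f rule: mpoly_induct) (simp_all add: subst_add subst_mult)

lemma subst_mvar_id [simp]: "subst mvar f = f"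
  by (induction f rule: mpoly_induct) (simp_all add: subst_add subst_mult)

lemma subst_cong: "(\<And>i. i \<in> vars f \<Longrightarrow> g i = h i) \<Longrightarrow> subst g f = subst h f"
  unfolding subst_def vars_def
  by (rule sum.cong[OF refl], rule arg_cong[where f = "(*) _"], rule prod.cong[OF refl]) (metis (mono_tags, lifting) mem_Collect_eq)

section \<open>Variables occurring in a polynomial\<close>

lemma vars_0 [simp]: "vars 0 = {}"
  by (simp add: vars_def)

lemma vars_mconst [simp]: "vars (mconst c) = {}"
  by (auto simp: vars_def mconst_def)

lemma vars_mvar [simp]: "vars (mvar i :: 'a::comm_ring_1 mpoly) = {i}"
  by (auto simp: vars_def mvar_def)

lemma vars_add: "vars (f + g) \<subseteq> vars f \<union> vars g"
  unfolding vars_def using keys_add[of f g] by blast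

lemma vars_mult: "vars (f * g) \<subseteq> vars f \<union> vars g"
  unfolding vars_def using keys_mult[of f g] keys_add by fastforce

lemma vars_sum: "(\<And>i. i \<in> I \<Longrightarrow> vars (F i) \<subseteq> V) \<Longrightarrow> vars (\<Sum>i\<in>I. F i) \<subseteq> V"
  by (induction I rule: infinite_finite_induct) (use vars_add in fastforce)+

lemma finite_vars [simp]: "finite (vars f)"
proof -
  have "vars f = (\<Union>m\<in>Poly_Mapping.keys f. Poly_Mapping.keys m)"
    by (auto simp: vars_def)
  then show ?thesis by simp
qed

lemma vars_empty_imp_mconst:
  assumes "vars f = {}"
  shows "\<exists>c. f = mconst c"
proof -
  have "Poly_Mapping.keys f \<subseteq> {0}"
    using assms unfolding vars_def by (auto simp: poly_mapping_eq_iff fun_eq_iff in_keys_iff) 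
  then have "f = Poly_Mapping.single 0 (Poly_Mapping.lookup f 0)"
    by (intro poly_mapping_eqI) (auto simp: lookup_single when_def in_keys_iff subset_iff)
  then show ?thesis by (auto simp: mconst_def)
qed

section \<open>Formal partial derivatives\<close>

definition pd :: "nat \<Rightarrow> 'a::comm_ring_1 mpoly \<Rightarrow> 'a mpoly" where
  "pd l f = (\<Sum>m\<in>Poly_Mapping.keys f.
     Poly_Mapping.single (m - Poly_Mapping.single l 1) (of_nat (Poly_Mapping.lookup m l) * Poly_Mapping.lookup f m))"

lemma pd_superset:
  assumes "finite K" "Poly_Mapping.keys f \<subseteq> K"
  shows "pd l f = (\<Sum>m\<in>K.
     Poly_Mapping.single (m - Poly_Mapping.single l 1) (of_nat (Poly_Mapping.lookup m l) * Poly_Mapping.lookup f m))"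
  unfolding pd_def using assms by (intro sum.mono_neutral_left) (auto simp: in_keys_iff)

lemma pd_add: "pd l (f1 + f2) = pd l f1 + pd l f2"
proof -
  let ?K = "Poly_Mapping.keys f1 \<union> Poly_Mapping.keys f2"
  have "Poly_Mapping.keys (f1 + f2) \<subseteq> ?K" by (rule keys_add)
  then show ?thesis
    by (simp add: pd_superset[of ?K] lookup_add distrib_left single_add sum.distrib)
qed

lemma pd_0 [simp]: "pd l 0 = 0"
  by (simp add: pd_def)

lemma pd_uminus: "pd l (- f) = - pd l f"
  by (metis add.inverse_inverse add_eq_0_iff pd_add pd_0)

lemma pd_diff: "pd l (f1 - f2) = pd l f1 - pd l f2"
  by (metis add_uminus_conv_diff pd_add pd_uminus)

lemma pd_sum: "pd l (\<Sum>i\<in>I. F i) = (\<Sum>i\<in>I. pd l (F i))"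
  by (induction I rule: infinite_finite_induct) (simp_all add: pd_add)

lemma pd_single:
  "pd l (Poly_Mapping.single m c) = Poly_Mapping.single (m - Poly_Mapping.single l 1) (of_nat (Poly_Mapping.lookup m l) * c)"
  by (simp add: pd_superset[of "{m}"])

lemma pd_mult: "pd l (f1 * f2) = pd l f1 * f2 + f1 * pd l f2"
proof -
  \<comment> \<open>Subtraction of exponents is truncated and moves past \<open>m2\<close> only if
    \<open>l\<close> occurs in \<open>m1\<close>. If it does not, the coefficient is zero and the
    exponent is irrelevant.\<close>
  have key: "of_nat (Poly_Mapping.lookup m1 l) \<noteq> (0::'a) \<Longrightarrow>
      m1 - Poly_Mapping.single l 1 + m2 = m1 + m2 - Poly_Mapping.single l (1::nat)" for m1 m2 :: "nat \<Rightarrow>\<^sub>0 nat"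
    by (rule poly_mapping_eqI) (cases "Poly_Mapping.lookup m1 l", auto simp: lookup_add lookup_minus lookup_single when_def)
  have *: "pd l (Poly_Mapping.single m1 c1 * Poly_Mapping.single m2 c2) =
    pd l (Poly_Mapping.single m1 c1) * Poly_Mapping.single m2 c2 + Poly_Mapping.single m1 c1 * pd l (Poly_Mapping.single m2 c2)"
    for m1 m2 :: "nat \<Rightarrow>\<^sub>0 nat" and c1 c2 :: 'a
  proof -
    have 1: "Poly_Mapping.single (m1 - Poly_Mapping.single l 1 + m2) (of_nat (Poly_Mapping.lookup m1 l) * c1 * c2)
      = Poly_Mapping.single (m1 + m2 - Poly_Mapping.single l (1::nat)) (of_nat (Poly_Mapping.lookup m1 l) * c1 * c2)"
      using key[of m1 m2] by (cases "of_nat (Poly_Mapping.lookup m1 l) = (0::'a)") auto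
    have 2: "Poly_Mapping.single (m1 + (m2 - Poly_Mapping.single l 1)) (c1 * (of_nat (Poly_Mapping.lookup m2 l) * c2))
      = Poly_Mapping.single (m1 + m2 - Poly_Mapping.single l (1::nat)) (c1 * (of_nat (Poly_Mapping.lookup m2 l) * c2))"
      using key[of m2 m1] by (cases "of_nat (Poly_Mapping.lookup m2 l) = (0::'a)") (auto simp: add.commute)
    show ?thesis
      unfolding pd_single mult_single 1 2 by (simp add: single_add [symmetric] lookup_add algebra_simps)
  qed
  let ?s = "\<lambda>f. \<Sum>m\<in>Poly_Mapping.keys f. Poly_Mapping.single m (Poly_Mapping.lookup f m)"
  have "pd l (?s f1 * ?s f2) = pd l (?s f1) * ?s f2 + ?s f1 * pd l (?s f2)"
    by (simp only: sum_product pd_sum * sum.distrib)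
  then show ?thesis by (simp add: sum_single_lookup)
qed

lemma pd_mconst [simp]: "pd l (mconst c) = 0"
  by (simp add: mconst_def pd_single)

lemma pd_1 [simp]: "pd l 1 = 0"
  by (metis mconst_1 pd_mconst)

lemma pd_mvar: "pd l (mvar i) = (if i = l then 1 else 0)"
  by (simp add: mvar_def pd_single lookup_single when_def)

lemma vars_pd: "vars (pd l f) \<subseteq> vars f"
proof -
  have "vars (Poly_Mapping.single (m - Poly_Mapping.single l 1) (of_nat (Poly_Mapping.lookup m l) * Poly_Mapping.lookup f m))
    \<subseteq> vars f" if "m \<in> Poly_Mapping.keys f" for m
    using that by (auto simp: vars_def in_keys_iff lookup_minus intro!: bexI[of _ m])
  then show ?thesis unfolding pd_def by (intro vars_sum)
qed

lemma pd_eq_0_if_notin_vars: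
  assumes "l \<notin> vars f"
  shows "pd l f = 0"
  unfolding pd_def using assms by (intro sum.neutral) (auto simp: vars_def in_keys_iff)

lemma lookup_pd:
  "Poly_Mapping.lookup (pd l f) m =
   of_nat (Suc (Poly_Mapping.lookup m l)) * Poly_Mapping.lookup f (m + Poly_Mapping.single l 1)"
proof -
  \<comment> \<open>The condition on the exponent of \<open>l\<close> excludes \<open>m' = m\<close>
    with exponent 0, a second preimage caused by truncated subtraction.\<close>
  have eq: "(m' - Poly_Mapping.single l 1 = m \<and> Poly_Mapping.lookup m' l \<noteq> 0) \<longleftrightarrow> m' = m + Poly_Mapping.single l 1"
    for m' :: "nat \<Rightarrow>\<^sub>0 nat"
    by (auto simp: poly_mapping_eq_iff fun_eq_iff lookup_add lookup_minus lookup_single when_def split: if_splits)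
  have "Poly_Mapping.lookup (Poly_Mapping.single (m' - Poly_Mapping.single l 1) (of_nat (Poly_Mapping.lookup m' l) * Poly_Mapping.lookup f m')) m
     = (if m' = m + Poly_Mapping.single l 1 then of_nat (Poly_Mapping.lookup m' l) * Poly_Mapping.lookup f m' else 0)"
    for m' :: "nat \<Rightarrow>\<^sub>0 nat"
    unfolding lookup_single when_def eq [symmetric] by auto
  then have "Poly_Mapping.lookup (pd l f) m = (\<Sum>m'\<in>Poly_Mapping.keys f.
      if m' = m + Poly_Mapping.single l 1 then of_nat (Poly_Mapping.lookup m' l) * Poly_Mapping.lookup f m' else 0)"
    by (simp add: pd_def lookup_sum)
  then show ?thesis
    by (simp add: in_keys_iff lookup_add)
qed

text \<open>A monomial containing the variable contributes its coefficient times a positive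
  exponent, which is nonzero in characteristic zero, and distinct such monomials do not
  interfere.\<close>

lemma pd_eq_0_imp_notin_vars:
  fixes f :: "'a::{idom,ring_char_0} mpoly"
  assumes "pd l f = 0"
  shows "l \<notin> vars f"
proof
  assume "l \<in> vars f"
  then obtain m where m: "m \<in> Poly_Mapping.keys f" "Poly_Mapping.lookup m l \<noteq> 0"
    by (auto simp: vars_def in_keys_iff)
  then have "m - Poly_Mapping.single l 1 + Poly_Mapping.single l 1 = m"
    by (intro poly_mapping_eqI) (auto simp: lookup_add lookup_minus lookup_single when_def)
  with m assms show False
    using lookup_pd[of l f "m - Poly_Mapping.single l 1"]
    by (simp add: in_keys_iff del: of_nat_Suc)
qed

text \<open>The bound is strict so that \<open>deg_lt 0\<close> singles out the zero polynomial.
  This is the base of the degree inductions, in which a partial derivative lowers the bound by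
  one.\<close>

definition deg_lt :: "nat \<Rightarrow> 'a::zero mpoly \<Rightarrow> bool" where
  "deg_lt d f \<longleftrightarrow> (\<forall>m\<in>Poly_Mapping.keys f. (\<Sum>i\<in>Poly_Mapping.keys m. Poly_Mapping.lookup m i) < d)"

lemma deg_lt_0_iff [simp]: "deg_lt 0 f \<longleftrightarrow> f = 0"
  by (auto simp: deg_lt_def)

lemma deg_lt_exists: "\<exists>d. deg_lt d f"
proof -
  let ?s = "\<lambda>m :: nat \<Rightarrow>\<^sub>0 nat. \<Sum>i\<in>Poly_Mapping.keys m. Poly_Mapping.lookup m i"
  have "\<forall>m\<in>Poly_Mapping.keys f. ?s m \<le> (\<Sum>m\<in>Poly_Mapping.keys f. ?s m)"
    by (intro ballI member_le_sum) auto
  then show ?thesis unfolding deg_lt_def using le_imp_less_Suc by blast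
qed

lemma deg_lt_pd:
  assumes "deg_lt (Suc d) f"
  shows "deg_lt d (pd l f)"
  unfolding deg_lt_def
proof
  fix m assume "m \<in> Poly_Mapping.keys (pd l f)"
  then have "m + Poly_Mapping.single l 1 \<in> Poly_Mapping.keys f"
    by (auto simp: in_keys_iff lookup_pd)
  with assms have *: "(\<Sum>i\<in>Poly_Mapping.keys (m + Poly_Mapping.single l 1). Poly_Mapping.lookup (m + Poly_Mapping.single l 1) i) < Suc d"
    by (auto simp: deg_lt_def)
  have "(\<Sum>i\<in>Poly_Mapping.keys (m + Poly_Mapping.single l 1). Poly_Mapping.lookup (m + Poly_Mapping.single l 1) i)
     = (\<Sum>i\<in>insert l (Poly_Mapping.keys m). Poly_Mapping.lookup m i + (1 when i = l))"
    by (rule sum.mono_neutral_cong) (auto simp: in_keys_iff lookup_add lookup_single when_def)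
  also have "\<dots> = (\<Sum>i\<in>insert l (Poly_Mapping.keys m). Poly_Mapping.lookup m i) + 1"
    by (simp add: sum.distrib when_def)
  also have "(\<Sum>i\<in>insert l (Poly_Mapping.keys m). Poly_Mapping.lookup m i) = (\<Sum>i\<in>Poly_Mapping.keys m. Poly_Mapping.lookup m i)"
    by (rule sum.mono_neutral_right) (auto simp: in_keys_iff)
  finally show "(\<Sum>i\<in>Poly_Mapping.keys m. Poly_Mapping.lookup m i) < d" using * by simp
qed

lemma deg_lt_add: "deg_lt d f \<Longrightarrow> deg_lt d g \<Longrightarrow> deg_lt d (f + g)"
  unfolding deg_lt_def using keys_add[of f g] by blast

lemma deg_lt_sum: "(\<And>i. i \<in> I \<Longrightarrow> deg_lt d (F i)) \<Longrightarrow> deg_lt d (\<Sum>i\<in>I. F i)"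
proof (induction I rule: infinite_finite_induct)
  case (insert i I)
  then show ?case by (simp add: deg_lt_add)
qed (simp_all add: deg_lt_def)

lemma lookup_mult_mconst: "Poly_Mapping.lookup (f * mconst c) m = Poly_Mapping.lookup f m * c"
proof -
  have "f * mconst c = Poly_Mapping.map ((*) c) f"
    by (simp add: mconst_def mult.commute mult_map_scale_conv_mult)
  then show ?thesis by (simp add: Poly_Mapping.map.rep_eq when_def mult.commute)
qed

lemma deg_lt_mult_mconst: "deg_lt d f \<Longrightarrow> deg_lt d (f * mconst c)"
  unfolding deg_lt_def by (auto simp: in_keys_iff lookup_mult_mconst)

subsection \<open>Derivations of the field of rational functions\<close>

text \<open>Here \<open>D\<close> is a derivation along a ring homomorphism \<open>h\<close>. With
  \<open>h\<close> the identity this covers partial derivatives of polynomials, and with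
  \<open>h = emb\<close> derivations of the fraction field restricted to polynomials.\<close>

lemma chain_rule:
  fixes h :: "'a::comm_ring_1 mpoly \<Rightarrow> 'r::comm_ring_1" and g :: "nat \<Rightarrow> 'a mpoly"
  assumes h_add: "\<And>x y. h (x + y) = h x + h y" and h_mult: "\<And>x y. h (x * y) = h x * h y" and h_1: "h 1 = 1"
    and D_add: "\<And>x y. D (x + y) = D x + D y"
    and D_mult: "\<And>x y. D (x * y) = D x * h y + h x * D y"
    and D_mconst: "\<And>c. D (mconst c) = 0"
    and J: "finite J" "vars f \<subseteq> J"
  shows "D (subst g f) = (\<Sum>j\<in>J. h (subst g (pd j f)) * D (g j))"
proof -
  have h_0: "h 0 = 0" using h_add[of 0 0] by simp
  \<comment> \<open>The two parts of a sum or product come with different index sets, so the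
    induction claims the formula for every sufficiently large finite set. Surplus indices are
    discarded at the end.\<close>
  have "\<exists>J0. finite J0 \<and> (\<forall>J. finite J \<longrightarrow> J0 \<subseteq> J \<longrightarrow>
      D (subst g f) = (\<Sum>j\<in>J. h (subst g (pd j f)) * D (g j)))"
  proof (induction f rule: mpoly_induct)
    case (const c)
    then show ?case by (auto simp: D_mconst h_0)
  next
    case (var i)
    have "h (subst g (pd j (mvar i))) * D (g j) = (if j = i then D (g j) else 0)" for j
      by (simp add: pd_mvar h_0 h_1)
    then show ?case by (intro exI[of _ "{i}"]) auto
  next
    case (add f1 f2)
    then obtain J1 J2 where "finite J1" "finite J2"
      "\<And>J. finite J \<Longrightarrow> J1 \<subseteq> J \<Longrightarrow> D (subst g f1) = (\<Sum>j\<in>J. h (subst g (pd j f1)) * D (g j))"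
      "\<And>J. finite J \<Longrightarrow> J2 \<subseteq> J \<Longrightarrow> D (subst g f2) = (\<Sum>j\<in>J. h (subst g (pd j f2)) * D (g j))"
      by blast
    then show ?case
      by (intro exI[of _ "J1 \<union> J2"])
        (auto simp: subst_add pd_add D_add h_add distrib_right sum.distrib)
  next
    case (mult f1 f2)
    then obtain J1 J2 where J12: "finite J1" "finite J2"
      "\<And>J. finite J \<Longrightarrow> J1 \<subseteq> J \<Longrightarrow> D (subst g f1) = (\<Sum>j\<in>J. h (subst g (pd j f1)) * D (g j))"
      "\<And>J. finite J \<Longrightarrow> J2 \<subseteq> J \<Longrightarrow> D (subst g f2) = (\<Sum>j\<in>J. h (subst g (pd j f2)) * D (g j))"
      by blast
    have "D (subst g (f1 * f2)) = (\<Sum>j\<in>J. h (subst g (pd j (f1 * f2))) * D (g j))"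
      if "finite J" "J1 \<union> J2 \<subseteq> J" for J
    proof -
      have "D (subst g (f1 * f2)) = D (subst g f1) * h (subst g f2) + h (subst g f1) * D (subst g f2)"
        by (simp add: subst_mult D_mult)
      also have "\<dots> = (\<Sum>j\<in>J. h (subst g (pd j (f1 * f2))) * D (g j))"
        using that J12(3)[of J] J12(4)[of J]
        by (simp add: sum_distrib_left sum_distrib_right sum.distrib [symmetric]
            pd_mult subst_add subst_mult h_add h_mult algebra_simps)
      finally show ?thesis .
    qed
    then show ?case using J12(1,2) by (intro exI[of _ "J1 \<union> J2"]) auto
  qed
  then obtain J0 where J0: "finite J0" "\<And>J. finite J \<Longrightarrow> J0 \<subseteq> J \<Longrightarrow>
      D (subst g f) = (\<Sum>j\<in>J. h (subst g (pd j f)) * D (g j))" by blast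
  have "D (subst g f) = (\<Sum>j\<in>J \<union> J0. h (subst g (pd j f)) * D (g j))"
    by (rule J0(2)) (use J0(1) J in auto)
  also have "\<dots> = (\<Sum>j\<in>J. h (subst g (pd j f)) * D (g j))"
  proof (intro sum.mono_neutral_right ballI)
    fix i assume "i \<in> J \<union> J0 - J"
    then have "pd i f = 0" using J(2) by (intro pd_eq_0_if_notin_vars) auto
    then show "h (subst g (pd i f)) * D (g i) = 0" by (simp add: h_0)
  qed (use J(1) J0(1) in auto)
  finally show ?thesis .
qed

lemma pd_subst:
  assumes "finite J" "vars f \<subseteq> J"
  shows "pd l (subst g f) = (\<Sum>j\<in>J. subst g (pd j f) * pd l (g j))"
  by (rule chain_rule[of "\<lambda>x. x" "pd l", OF _ _ _ _ _ _ assms]) (simp_all add: pd_add pd_mult)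

lemma subst_mvar_upd_fresh:
  assumes "n \<notin> vars f"
  shows "subst (mvar(n := c)) f = f"
proof -
  have "subst (mvar(n := c)) f = subst mvar f"
    using assms by (intro subst_cong) auto
  then show ?thesis by simp
qed

text \<open>Integrates a first-order condition. The derivative in t of \<open>f(g + t p)\<close> is
  \<open>f'(g + t p)\<close> with \<open>f'\<close> the derivative of \<open>f\<close> in direction
  \<open>p\<close>. By \<open>closed\<close>, \<open>f'\<close> is again a relation, of smaller
  degree, so by induction that derivative is zero. Hence \<open>f(g + t p)\<close> is free of t, and
  t = 0 gives \<open>f(g) = 0\<close>.\<close>

lemma subst_translate_eq_0:
  fixes g :: "nat \<Rightarrow> 'a::{idom,ring_char_0} mpoly"
  assumes I: "finite I" and fresh: "\<And>i. i \<in> I \<Longrightarrow> n \<notin> vars (g i)"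
    and closed: "\<And>f. vars f \<subseteq> I \<Longrightarrow> subst g f = 0 \<Longrightarrow> (\<Sum>j\<in>I. subst g (pd j f) * mconst (p j)) = 0"
    and f: "vars f \<subseteq> I" "subst g f = 0"
  shows "subst (\<lambda>i. g i + mvar n * mconst (p i)) f = 0"
proof -
  let ?G = "\<lambda>i. g i + mvar n * mconst (p i)"
  obtain d where "deg_lt d f" using deg_lt_exists by blast
  then show ?thesis using f
  proof (induction d arbitrary: f)
    case 0
    then show ?case by simp
  next
    case (Suc d)
    define f' where "f' = (\<Sum>j\<in>I. pd j f * mconst (p j))"
    have "vars (pd j f * mconst (p j)) \<subseteq> I" for j
      using vars_mult[of "pd j f" "mconst (p j)"] vars_pd[of j f] Suc.prems(2) by auto
    then have "vars f' \<subseteq> I" unfolding f'_def by (rule vars_sum)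
    moreover have "subst g f' = 0"
      unfolding f'_def using closed[OF Suc.prems(2,3)] by (simp add: subst_sum subst_mult)
    moreover have "deg_lt d f'"
      unfolding f'_def by (intro deg_lt_sum deg_lt_mult_mconst deg_lt_pd Suc.prems)
    ultimately have "subst ?G f' = 0" using Suc.IH by blast
    moreover have "pd n (subst ?G f) = subst ?G f'"
      unfolding pd_subst[OF I Suc.prems(2)] f'_def subst_sum
      by (intro sum.cong refl) (simp add: subst_mult pd_add pd_mult pd_mvar pd_eq_0_if_notin_vars fresh)
    ultimately have "n \<notin> vars (subst ?G f)" by (intro pd_eq_0_imp_notin_vars) simp
    then have "subst ?G f = subst (mvar(n := 0)) (subst ?G f)"
      by (simp add: subst_mvar_upd_fresh)
    also have "\<dots> = subst g f"
      unfolding subst_subst using Suc.prems(2) fresh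
      by (intro subst_cong) (auto simp: subst_add subst_mult subst_mvar_upd_fresh)
    finally show ?case using Suc.prems(3) by simp
  qed
qed

text \<open>The opposite passage: differentiate a relation along a curve \<open>G\<close> and
  specialise. With \<open>\<tau>\<close> setting t = 0, \<open>g\<close> is the base point of the
  curve and \<open>p\<close> its velocity.\<close>

lemma sum_pd_eq_0_of_subst_eq_0:
  assumes "finite I" "vars f \<subseteq> I" "subst G f = 0"
    and "\<And>i. i \<in> I \<Longrightarrow> subst \<tau> (G i) = g i" "\<And>i. i \<in> I \<Longrightarrow> subst \<tau> (pd n (G i)) = p i"
  shows "(\<Sum>j\<in>I. subst g (pd j f) * p j) = 0"
proof -
  have "0 = subst \<tau> (pd n (subst G f))" using assms(3) by simp
  also have "\<dots> = (\<Sum>j\<in>I. subst \<tau> (subst G (pd j f)) * subst \<tau> (pd n (G j)))"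
    by (simp add: pd_subst[OF assms(1,2)] subst_sum subst_mult)
  also have "\<dots> = (\<Sum>j\<in>I. subst g (pd j f) * p j)"
  proof (intro sum.cong refl arg_cong2[where f = "(*)"])
    fix j assume "j \<in> I"
    show "subst \<tau> (subst G (pd j f)) = subst g (pd j f)"
      unfolding subst_subst using assms(2,4) vars_pd[of j f] by (intro subst_cong) auto
  qed (use assms(5) in auto)
  finally show ?thesis by simp
qed

section \<open>Derivations of the fraction field over the constants\<close>

abbreviation emb :: "'a::idom mpoly \<Rightarrow> 'a mpoly fract" where
  "emb f \<equiv> Fract f 1"

lemma emb_add: "emb (f + g) = emb f + emb g" by simp
lemma emb_mult: "emb (f * g) = emb f * emb g" by simp
lemma emb_0 [simp]: "emb 0 = 0" by (simp add: Zero_fract_def)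
lemma emb_1: "emb 1 = 1" by (simp add: One_fract_def)
lemma emb_eq_0_iff: "emb f = 0 \<longleftrightarrow> f = 0" by (simp add: Zero_fract_def eq_fract del: emb_0)
lemma emb_sum: "emb (\<Sum>i\<in>I. f i) = (\<Sum>i\<in>I. emb (f i))"
  by (induction I rule: infinite_finite_induct) (simp_all only: sum.insert sum.empty sum.infinite emb_add emb_0 if_False not_False_eq_True)

definition derivation :: "('a::idom mpoly fract \<Rightarrow> 'a mpoly fract) \<Rightarrow> bool" where
  "derivation D \<longleftrightarrow> (\<forall>x y. D (x + y) = D x + D y) \<and> (\<forall>x y. D (x * y) = D x * y + x * D y) \<and>
     (\<forall>c. D (emb (mconst c)) = 0)"

lemma derivation_add: "derivation D \<Longrightarrow> D (x + y) = D x + D y"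
  and derivation_mult: "derivation D \<Longrightarrow> D (x * y) = D x * y + x * D y"
  and derivation_mconst: "derivation D \<Longrightarrow> D (emb (mconst c)) = 0"
  by (simp_all add: derivation_def)

lemma derivation_0: "derivation D \<Longrightarrow> D 0 = 0"
  by (metis add_cancel_right_right add_0 derivation_add)

lemma derivation_minus: "derivation D \<Longrightarrow> D (- x) = - D x"
  using derivation_add[of D x "-x"] derivation_0[of D] by (simp add: eq_neg_iff_add_eq_0 add.commute)

lemma derivation_diff: "derivation D \<Longrightarrow> D (x - y) = D x - D y"
  using derivation_add[of D x "-y"] derivation_minus[of D y] by simp

lemma derivation_commutator:
  assumes "derivation D" "derivation E"
  shows "derivation (\<lambda>x. D (E x) - E (D x))"
  using assms unfolding derivation_def
  by (auto simp: algebra_simps derivation_0[OF assms(1)] derivation_0[OF assms(2)])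

lemma derivation_subst:
  assumes D: "derivation D" and J: "finite J" "vars f \<subseteq> J"
  shows "D (emb (subst g f)) = (\<Sum>j\<in>J. emb (subst g (pd j f)) * D (emb (g j)))"
proof (rule chain_rule[of emb "\<lambda>x. D (emb x)", OF _ _ _ _ _ _ J])
qed (simp_all only: emb_add emb_mult emb_1 derivation_add[OF D] derivation_mult[OF D] derivation_mconst[OF D])

text \<open>Independence of the quotient rule from the representative: \<open>a\<close>,
  \<open>b\<close>, \<open>a'\<close>, \<open>b'\<close> stand for the derivatives of
  \<open>p\<close>, \<open>q\<close>, \<open>p'\<close>, \<open>q'\<close>, and the second
  hypothesis is the derivative of the first.\<close>

lemma quotient_rule_cong:
  fixes p q :: "'r::idom"
  assumes "p * q' = p' * q" "a * q' + p * b' = a' * q + p' * b"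
  shows "(a * q - p * b) * (q' * q') = (a' * q' - p' * b') * (q * q)"
  using assms by algebra

lemma quotient_rule_add:
  fixes p q :: "'r::comm_ring_1"
  shows "(a * q' + p * b' + (a' * q + p' * b)) * (q * q') - (p * q' + p' * q) * (b * q' + q * b')
    = (a * q - p * b) * (q' * q') + (a' * q' - p' * b') * (q * q)"
  by (simp add: algebra_simps)

lemma quotient_rule_mult:
  fixes p q :: "'r::comm_ring_1"
  shows "((a * p' + p * a') * (q * q') - p * p' * (b * q' + q * b')) * (q * q * q' * (q * (q' * q')))
    = ((a * q - p * b) * p' * (q * (q' * q')) + p * (a' * q' - p' * b') * (q * q * q')) * (q * q' * (q * q'))"
  by (simp add: algebra_simps)

text \<open>The partial derivative by the quotient rule on an arbitrarily chosen representative;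
  \<open>dfr_Fract\<close> shows that the choice does not matter.\<close>

definition dfr :: "nat \<Rightarrow> 'a::idom mpoly fract \<Rightarrow> 'a mpoly fract" where
  "dfr l x = (let r = SOME r. snd r \<noteq> 0 \<and> x = Fract (fst r) (snd r)
     in Fract (pd l (fst r) * snd r - fst r * pd l (snd r)) (snd r * snd r))"

lemma dfr_Fract:
  assumes "q \<noteq> 0"
  shows "dfr l (Fract p q) = Fract (pd l p * q - p * pd l q) (q * q)"
proof -
  define r where "r = (SOME r. snd r \<noteq> 0 \<and> Fract p q = Fract (fst r) (snd r))"
  define p' q' where "p' = fst r" and "q' = snd r"
  have "snd r \<noteq> 0 \<and> Fract p q = Fract (fst r) (snd r)"
    unfolding r_def
    by (rule someI[of "\<lambda>r. snd r \<noteq> 0 \<and> Fract p q = Fract (fst r) (snd r)" "(p, q)"]) (simp add: assms)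
  then have q': "q' \<noteq> 0" and eq: "p * q' = p' * q" using assms by (auto simp: eq_fract p'_def q'_def)
  have "pd l p * q' + p * pd l q' = pd l p' * q + p' * pd l q"
    using arg_cong[OF eq, of "pd l"] by (simp add: pd_mult)
  from quotient_rule_cong[OF eq this]
  have "(pd l p * q - p * pd l q) * (q' * q') = (pd l p' * q' - p' * pd l q') * (q * q)" .
  then show ?thesis
    unfolding dfr_def Let_def r_def [symmetric] p'_def [symmetric] q'_def [symmetric]
    using assms q' by (simp add: eq_fract)
qed

lemma dfr_emb: "dfr l (emb f) = emb (pd l f)"
  by (simp add: dfr_Fract)

lemma derivation_dfr: "derivation (dfr l)"
  unfolding derivation_def
proof (intro conjI allI)
  fix x y :: "'a mpoly fract"
  obtain p q where x: "x = Fract p q" "q \<noteq> 0" by (cases x)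
  obtain p' q' where y: "y = Fract p' q'" "q' \<noteq> 0" by (cases y)
  show "dfr l (x + y) = dfr l x + dfr l y"
    using x y quotient_rule_add[of "pd l p" q' p "pd l q'" "pd l p'" q p' "pd l q"]
    by (simp add: dfr_Fract eq_fract pd_add pd_mult)
  show "dfr l (x * y) = dfr l x * y + x * dfr l y"
  proof -
    have "dfr l (x * y) = Fract ((pd l p * p' + p * pd l p') * (q * q') - p * p' * (pd l q * q' + q * pd l q')) (q * q' * (q * q'))"
      using x y by (simp add: dfr_Fract pd_mult)
    also have "\<dots> = Fract ((pd l p * q - p * pd l q) * p' * (q * (q' * q')) + p * (pd l p' * q' - p' * pd l q') * (q * q * q'))
        (q * q * q' * (q * (q' * q')))"
      using x y by (subst eq_fract) (simp_all only: quotient_rule_mult mult_eq_0_iff simp_thms)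
    also have "\<dots> = dfr l x * y + x * dfr l y"
      using x y by (simp only: dfr_Fract mult_fract add_fract mult_eq_0_iff simp_thms)
    finally show ?thesis .
  qed
next
  show "dfr l (emb (mconst c)) = 0" for c
    by (simp add: dfr_emb)
qed

definition grad :: "'a::idom mpoly fract \<Rightarrow> nat \<Rightarrow> 'a mpoly fract" where
  "grad x = (\<lambda>l. dfr l x)"

text \<open>Vanishing of the gradient of \<open>p / q\<close> means that
  \<open>pd l p * q = p * pd l q\<close>. So \<open>p / q\<close> equals the quotient of the partial
  derivatives whenever \<open>pd l q\<close> is nonzero, with a denominator of lower degree. If all
  partial derivatives of \<open>q\<close> vanish, so do those of \<open>p\<close>, and both are
  constants.\<close>

lemma grad_eq_0_imp_mconst:
  fixes x :: "'a::field_char_0 mpoly fract"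
  assumes "grad x = 0"
  shows "\<exists>c. x = emb (mconst c)"
proof -
  obtain p q where x: "x = Fract p q" "q \<noteq> 0" by (cases x)
  obtain d where "deg_lt d q" using deg_lt_exists by blast
  then show ?thesis using x
  proof (induction d arbitrary: p q)
    case 0
    then show ?case by simp
  next
    case (Suc d)
    have *: "pd l p * q = p * pd l q" for l
    proof -
      have "dfr l x = 0" using assms by (simp add: grad_def fun_eq_iff)
      with Suc.prems show ?thesis by (simp add: dfr_Fract Zero_fract_def eq_fract del: emb_0)
    qed
    show ?case
    proof (cases "\<exists>l. pd l q \<noteq> 0")
      case True
      then obtain l where l: "pd l q \<noteq> 0" by blast
      with *[of l] Suc.prems have "x = Fract (pd l p) (pd l q)" by (simp add: eq_fract)
      with l Suc show ?thesis using deg_lt_pd by blast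
    next
      case False
      with * Suc.prems(3) have "pd l p = 0" "pd l q = 0" for l by (metis mult_eq_0_iff mult_zero_right)+
      then have "vars p = {}" "vars q = {}" using pd_eq_0_imp_notin_vars by blast+
      then obtain a b where ab: "p = mconst a" "q = mconst b" by (meson vars_empty_imp_mconst)
      then have "x = emb (mconst (a / b))"
        using Suc.prems(2,3) by (simp add: eq_fract flip: mconst_mult)
      then show ?thesis by blast
    qed
  qed
qed

subsection \<open>More polynomials than variables are algebraically dependent\<close>

text \<open>Dependence of an indexed family instead of a set: a repeated vector yields the relation
  with coefficients 1 and -1.\<close>

lemma (in vector_space) linear_relation_of_card_less:
  fixes v :: "'c \<Rightarrow> 'b"
  assumes A: "finite A" and B: "finite B" "card B < card A" and v: "\<And>m. m \<in> A \<Longrightarrow> v m \<in> span B"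
  shows "\<exists>u. (\<exists>m\<in>A. u m \<noteq> 0) \<and> (\<Sum>m\<in>A. scale (u m) (v m)) = 0"
proof (cases "inj_on v A")
  case True
  have "dependent (v ` A)"
  proof (rule ccontr)
    assume "independent (v ` A)"
    with B(1) v have "card (v ` A) \<le> card B" by (intro independent_span_bound[THEN conjunct2]) auto
    with B(2) True show False by (simp add: card_image)
  qed
  then obtain u where u: "\<exists>x\<in>v ` A. u x \<noteq> 0" "(\<Sum>x\<in>v ` A. scale (u x) x) = 0"
    using A by (auto simp: dependent_finite)
  then have "(\<Sum>m\<in>A. scale (u (v m)) (v m)) = 0" by (simp add: sum.reindex[OF True])
  with u(1) show ?thesis by (intro exI[of _ "u \<circ> v"]) auto
next
  case False
  then obtain a b where ab: "a \<in> A" "b \<in> A" "a \<noteq> b" "v a = v b" by (auto simp: inj_on_def)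
  define u :: "'c \<Rightarrow> 'a" where "u m = (if m = a then 1 else if m = b then - 1 else 0)" for m
  have "(\<Sum>m\<in>A. scale (u m) (v m)) = (\<Sum>m\<in>{a, b}. scale (u m) (v m))"
    by (rule sum.mono_neutral_right) (use A ab in \<open>auto simp: u_def\<close>)
  also have "\<dots> = 0" using ab by (simp add: u_def)
  finally show ?thesis using ab(1) by (intro exI[of _ u]) (auto simp: u_def)
qed

text \<open>Exponents are bounded one by one and not in total, so that counting monomials gives a
  plain power.\<close>

definition bmon :: "nat set \<Rightarrow> nat \<Rightarrow> (nat \<Rightarrow>\<^sub>0 nat) set" where
  "bmon V e = {m. Poly_Mapping.keys m \<subseteq> V \<and> (\<forall>i. Poly_Mapping.lookup m i \<le> e)}"

lemma bmon_mono: "e \<le> e' \<Longrightarrow> bmon V e \<subseteq> bmon V e'"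
  by (auto simp: bmon_def intro: order_trans)

lemma bmon_bij:
  assumes "finite V"
  shows "bij_betw (\<lambda>m. restrict (Poly_Mapping.lookup m) V) (bmon V e) (PiE V (\<lambda>_. {..e}))"
proof (rule bij_betw_byWitness[where f' = "\<lambda>f. \<Sum>i\<in>V. Poly_Mapping.single i (f i)"])
  show "\<forall>m\<in>bmon V e. (\<Sum>i\<in>V. Poly_Mapping.single i (restrict (Poly_Mapping.lookup m) V i)) = m"
  proof
    fix m assume "m \<in> bmon V e"
    then have "(\<Sum>i\<in>V. Poly_Mapping.single i (Poly_Mapping.lookup m i)) = (\<Sum>i\<in>Poly_Mapping.keys m. Poly_Mapping.single i (Poly_Mapping.lookup m i))"
      using assms by (intro sum.mono_neutral_right) (auto simp: bmon_def in_keys_iff)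
    then show "(\<Sum>i\<in>V. Poly_Mapping.single i (restrict (Poly_Mapping.lookup m) V i)) = m"
      by (simp add: sum_single_lookup)
  qed
  have lk: "Poly_Mapping.lookup (\<Sum>i\<in>V. Poly_Mapping.single i (f i)) j = (if j \<in> V then f j else 0)" for f :: "nat \<Rightarrow> nat" and j
    using assms by (simp add: lookup_sum lookup_single when_def)
  show "\<forall>f\<in>PiE V (\<lambda>_. {..e}). restrict (Poly_Mapping.lookup (\<Sum>i\<in>V. Poly_Mapping.single i (f i))) V = f"
    by (auto simp: lk PiE_def extensional_def fun_eq_iff)
  show "(\<lambda>f. \<Sum>i\<in>V. Poly_Mapping.single i (f i)) ` PiE V (\<lambda>_. {..e}) \<subseteq> bmon V e"
    by (auto simp: bmon_def in_keys_iff lk PiE_def Pi_def split: if_splits)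
qed (auto simp: bmon_def)

lemma finite_bmon: "finite V \<Longrightarrow> finite (bmon V e)"
  using bij_betw_finite[OF bmon_bij[of V e]] by (simp add: finite_PiE)

lemma card_bmon: "finite V \<Longrightarrow> card (bmon V e) = Suc e ^ card V"
  using bij_betw_same_card[OF bmon_bij[of V e]] by (simp add: card_PiE)

lemma keys_mult_bmon:
  assumes "Poly_Mapping.keys f \<subseteq> bmon V a" "Poly_Mapping.keys g \<subseteq> bmon V b"
  shows "Poly_Mapping.keys (f * g) \<subseteq> bmon V (a + b)"
proof
  fix m assume "m \<in> Poly_Mapping.keys (f * g)"
  then obtain m1 m2 where "m = m1 + m2" "m1 \<in> Poly_Mapping.keys f" "m2 \<in> Poly_Mapping.keys g"
    using keys_mult[of f g] by auto
  moreover from this assms have "m1 \<in> bmon V a" "m2 \<in> bmon V b" by auto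
  ultimately show "m \<in> bmon V (a + b)"
    using keys_add[of m1 m2] by (auto simp: bmon_def lookup_add intro: add_mono)
qed

lemma keys_1_bmon: "Poly_Mapping.keys (1 :: 'a::comm_ring_1 mpoly) \<subseteq> bmon V e"
  by (auto simp: bmon_def)

lemma zero_in_bmon [simp]: "0 \<in> bmon V e"
  by (simp add: bmon_def)

lemma keys_prod_bmon:
  fixes g :: "nat \<Rightarrow> 'a::comm_ring_1 mpoly"
  assumes "finite S" "\<And>i. i \<in> S \<Longrightarrow> Poly_Mapping.keys (g i) \<subseteq> bmon V d"
  shows "Poly_Mapping.keys (\<Prod>i\<in>S. g i ^ e i) \<subseteq> bmon V (\<Sum>i\<in>S. e i * d)"
  using assms
proof (induction S rule: finite_induct)
  case empty
  then show ?case by (simp add: keys_1_bmon)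
next
  case (insert i S)
  have "Poly_Mapping.keys (g i ^ k) \<subseteq> bmon V (k * d)" for k
    by (induction k) (use insert in \<open>simp_all add: keys_1_bmon keys_mult_bmon\<close>)
  with insert show ?case by (simp add: keys_mult_bmon)
qed

text \<open>A dimension count. Monomials in the \<open>g i\<close> with exponents at most
  \<open>N\<close> become polynomials in n variables with exponents at most \<open>N * D\<close>.
  For large \<open>N\<close> there are more of the former than the latter space has dimensions, so a
  linear relation exists.\<close>

lemma algebraic_relation_of_card_gt:
  fixes g :: "nat \<Rightarrow> 'a::field mpoly"
  assumes I: "finite I" "n < card I" and g: "\<And>i. i \<in> I \<Longrightarrow> vars (g i) \<subseteq> {..<n}"
  shows "\<exists>F. F \<noteq> 0 \<and> vars F \<subseteq> I \<and> subst g F = 0"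
proof -
  interpret mv: vector_space "\<lambda>c (f :: 'a mpoly). mconst c * f"
    by unfold_locales (simp_all add: mconst_add mconst_mult algebra_simps)
  have "\<exists>d. \<forall>i\<in>I. Poly_Mapping.keys (g i) \<subseteq> bmon {..<n} d"
  proof -
    define X where "X = (\<Union>i\<in>I. \<Union>m\<in>Poly_Mapping.keys (g i). Poly_Mapping.lookup m ` Poly_Mapping.keys m)"
    have fin: "finite (insert 0 X)" using I(1) by (auto simp: X_def)
    have "Poly_Mapping.lookup m j \<le> Max (insert 0 X)" if "i \<in> I" "m \<in> Poly_Mapping.keys (g i)" for i m j
    proof (rule Max_ge[OF fin])
      show "Poly_Mapping.lookup m j \<in> insert 0 X"
        using that by (cases "j \<in> Poly_Mapping.keys m") (auto simp: X_def not_in_keys_iff_lookup_eq_zero)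
    qed
    then show ?thesis using g by (intro exI[of _ "Max (insert 0 X)"]) (fastforce simp: bmon_def vars_def)
  qed
  then obtain d where d: "\<And>i. i \<in> I \<Longrightarrow> Poly_Mapping.keys (g i) \<subseteq> bmon {..<n} d" by blast
  \<comment> \<open>The choice \<open>N = D ^ n\<close> gives
    \<open>(N D + 1)^n <= ((N + 1) D)^n = (N + 1)^n N < (N + 1)^(n + 1)\<close>, and the last term
    is at most the number of monomials in the \<open>g i\<close>.\<close>
  define D where "D = Suc (card I * d)"
  define N where "N = D ^ n"
  define A where "A = bmon I N"
  define B where "B = bmon {..<n} (N * D)"
  define v where "v m = subst g (Poly_Mapping.single m 1)" for m
  have "card B = Suc (N * D) ^ n" by (simp add: B_def card_bmon)
  also have "\<dots> \<le> (Suc N * D) ^ n" by (intro power_mono) (auto simp: D_def)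
  also have "\<dots> = Suc N ^ n * N" by (simp only: N_def power_mult_distrib)
  also have "\<dots> < Suc N ^ Suc n" by simp
  also have "\<dots> \<le> Suc N ^ card I" using I(2) by (intro power_increasing) auto
  also have "\<dots> = card A" using I(1) by (simp add: A_def card_bmon)
  finally have card: "card B < card A" .
  have fin: "finite A" "finite B" using I(1) by (auto simp: A_def B_def finite_bmon)
  let ?E = "(\<lambda>m. Poly_Mapping.single m (1::'a)) ` B"
  have "v m \<in> mv.span ?E" if "m \<in> A" for m
  proof -
    have m: "Poly_Mapping.keys m \<subseteq> I" "\<And>i. Poly_Mapping.lookup m i \<le> N" using that by (auto simp: A_def bmon_def)
    have "Poly_Mapping.keys (v m) \<subseteq> bmon {..<n} (\<Sum>i\<in>Poly_Mapping.keys m. Poly_Mapping.lookup m i * d)"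
      unfolding v_def subst_single using d m by (simp, intro keys_prod_bmon) auto
    also have "\<dots> \<subseteq> B" unfolding B_def
    proof (rule bmon_mono)
      have "(\<Sum>i\<in>Poly_Mapping.keys m. Poly_Mapping.lookup m i * d) \<le> (\<Sum>i\<in>Poly_Mapping.keys m. N * d)"
        using m by (intro sum_mono) auto
      also have "\<dots> \<le> card I * (N * d)" using card_mono[OF I(1) m(1)] by simp
      also have "\<dots> \<le> N * D" by (simp add: D_def)
      finally show "(\<Sum>i\<in>Poly_Mapping.keys m. Poly_Mapping.lookup m i * d) \<le> N * D" .
    qed
    finally have keys: "Poly_Mapping.keys (v m) \<subseteq> B" .
    have "(\<Sum>m'\<in>Poly_Mapping.keys (v m). mconst (Poly_Mapping.lookup (v m) m') * Poly_Mapping.single m' 1) \<in> mv.span ?E"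
      using keys by (intro mv.span_sum mv.span_scale mv.span_base) auto
    then show ?thesis by (simp add: mconst_def mult_single sum_single_lookup)
  qed
  moreover have "card ?E < card A" using card card_image_le[OF fin(2), of "\<lambda>m. Poly_Mapping.single m (1::'a)"] by simp
  ultimately obtain u where u: "\<exists>m\<in>A. u m \<noteq> 0" "(\<Sum>m\<in>A. mconst (u m) * v m) = 0"
    using mv.linear_relation_of_card_less[of A ?E v] fin by blast
  define F where "F = (\<Sum>m\<in>A. Poly_Mapping.single m (u m))"
  have lk: "Poly_Mapping.lookup F m = (if m \<in> A then u m else 0)" for m
    using fin(1) by (simp add: F_def lookup_sum lookup_single when_def)
  have "F \<noteq> 0" using u(1) lk by (metis lookup_zero)
  moreover have "vars F \<subseteq> I"
  proof
    fix i assume "i \<in> vars F"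
    then obtain m where "m \<in> A" "i \<in> Poly_Mapping.keys m"
      by (auto simp: vars_def in_keys_iff[of _ F] lk split: if_splits)
    then show "i \<in> I" by (auto simp: A_def bmon_def)
  qed
  moreover have "subst g F = 0"
    using u(2) by (simp add: F_def subst_sum v_def subst_single)
  ultimately show ?thesis by blast
qed

subsection \<open>Gradients and algebraic independence\<close>

abbreviation (input) sc :: "'b::field \<Rightarrow> ('i \<Rightarrow> 'b) \<Rightarrow> 'i \<Rightarrow> 'b" where
  "sc c v \<equiv> (\<lambda>i. c * v i)"

interpretation gv: vector_space_pair "sc :: 'b::field \<Rightarrow> ('i \<Rightarrow> 'b) \<Rightarrow> 'i \<Rightarrow> 'b" "(*) :: 'b \<Rightarrow> 'b \<Rightarrow> 'b"
  by unfold_locales (auto simp: fun_eq_iff algebra_simps)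

abbreviation functional :: "(('i \<Rightarrow> 'b::field) \<Rightarrow> 'b) \<Rightarrow> bool" where
  "functional \<phi> \<equiv> Vector_Spaces.linear sc (*) \<phi>"

lemma functionalI:
  assumes "\<And>v w. \<phi> (v + w) = \<phi> v + \<phi> w" "\<And>c v. \<phi> (sc c v) = c * \<phi> v"
  shows "functional \<phi>"
  using assms by (simp add: linear_iff gv.vs1.vector_space_axioms gv.vs2.vector_space_axioms)

text \<open>A basis of the span stays independent when \<open>v\<close> is added, so values 1 at
  \<open>v\<close> and 0 on the basis extend linearly. This supplies derivations that kill given
  functions but not another one.\<close>

lemma functional_separating_span:
  assumes "v \<notin> gv.vs1.span S"
  shows "\<exists>\<phi>. functional \<phi> \<and> \<phi> v = 1 \<and> (\<forall>x\<in>gv.vs1.span S. \<phi> x = 0)"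
proof -
  obtain B where B: "B \<subseteq> S" "gv.vs1.independent B" "S \<subseteq> gv.vs1.span B"
    by (rule gv.vs1.maximal_independent_subset)
  have span: "gv.vs1.span B = gv.vs1.span S"
    using B(1,3) gv.vs1.span_mono[of B S] gv.vs1.span_minimal[OF B(3) gv.vs1.subspace_span] by blast
  then have "gv.vs1.independent (insert v B)"
    using B(2) assms by (intro gv.vs1.independent_insertI) auto
  then obtain \<phi> where \<phi>: "functional \<phi>" "\<forall>x\<in>insert v B. \<phi> x = (if x = v then 1 else 0)"
    using gv.linear_independent_extend[of "insert v B" "\<lambda>x. if x = v then 1 else 0"] by blast
  have "v \<notin> B" using assms span gv.vs1.span_base by blast
  then have "\<phi> x = 0" if "x \<in> gv.vs1.span B" for x
    using \<phi>(2) by (intro gv.linear_eq_0_on_span[OF \<phi>(1) _ that]) auto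
  then show ?thesis using \<phi> span by (intro exI[of _ \<phi>]) auto
qed

lemma functional_add: "functional \<phi> \<Longrightarrow> \<phi> (\<lambda>i. v i + w i) = \<phi> v + \<phi> w"
  using gv.linear_add[of \<phi> v w] by (simp add: plus_fun_def)

lemma functional_scale: "functional \<phi> \<Longrightarrow> \<phi> (sc c v) = c * \<phi> v"
  by (rule gv.linear_scale)

lemma functional_0: "functional \<phi> \<Longrightarrow> \<phi> 0 = 0"
  by (rule gv.linear_0)

section \<open>Derivations obtained from gradients\<close>

lemma grad_add: "grad (x + y) = grad x + grad y"
  by (simp add: grad_def derivation_add[OF derivation_dfr] fun_eq_iff)

lemma grad_mult: "grad (x * y) = (\<lambda>l. y * grad x l + x * grad y l)"
  by (simp add: grad_def derivation_mult[OF derivation_dfr] fun_eq_iff)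

lemma grad_mconst: "grad (emb (mconst c)) = 0"
  by (simp add: grad_def derivation_mconst[OF derivation_dfr] fun_eq_iff)

lemma grad_emb: "grad (emb f) = (\<lambda>l. emb (pd l f))"
  by (simp add: grad_def dfr_emb)

text \<open>The gradient satisfies the Leibniz rule with scalar factors, which a functional
  preserves. Derivations with prescribed values are constructed in this way below.\<close>

lemma derivation_functional_grad:
  assumes "functional \<phi>"
  shows "derivation (\<lambda>x. \<phi> (grad x))"
  unfolding derivation_def
  by (simp add: grad_add grad_mult grad_mconst gv.linear_add[OF assms] functional_add[OF assms]
      functional_scale[OF assms] functional_0[OF assms] algebra_simps)

lemma derivation_eq_functional_grad:
  assumes "derivation D" "finite J" "vars f \<subseteq> J"
  shows "D (emb f) = (\<Sum>l\<in>J. D (emb (mvar l)) * grad (emb f) l)"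
  using derivation_subst[OF assms, of mvar] by (simp add: grad_emb mult.commute)

text \<open>A derivation such as a commutator is not given as a functional of the gradient. On
  polynomials in finitely many variables it agrees with the functional \<open>\<psi>\<close> whose
  coefficients are its values at the variables, and \<open>\<psi>\<close> vanishes on the
  span.\<close>

lemma derivation_eq_0_of_grad_in_span:
  assumes D: "derivation D" and S: "finite S" "\<And>g. g \<in> S \<Longrightarrow> D (emb g) = 0"
    and f: "grad (emb f) \<in> gv.vs1.span ((\<lambda>g. grad (emb g)) ` S)"
  shows "D (emb f) = 0"
proof -
  define J where "J = vars f \<union> (\<Union>g\<in>S. vars g)"
  define \<psi> where "\<psi> v = (\<Sum>l\<in>J. D (emb (mvar l)) * v l)" for v
  have J: "finite J" using S(1) by (simp add: J_def)
  have \<psi>: "functional \<psi>"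
    by (rule functionalI)
      (simp_all only: \<psi>_def plus_fun_def distrib_left sum.distrib sum_distrib_left mult.left_commute)
  have eq: "D (emb g) = \<psi> (grad (emb g))" if "vars g \<subseteq> J" for g
    unfolding \<psi>_def by (rule derivation_eq_functional_grad[OF D J that])
  have "\<psi> x = 0" if "x \<in> (\<lambda>g. grad (emb g)) ` S" for x
  proof -
    obtain g where g: "g \<in> S" "x = grad (emb g)" using \<open>x \<in> (\<lambda>g. grad (emb g)) ` S\<close> by blast
    then have "vars g \<subseteq> J" by (auto simp: J_def)
    then show ?thesis using eq[of g] S(2) g by simp
  qed
  then have "\<psi> (grad (emb f)) = 0" by (rule gv.linear_eq_0_on_span[OF \<psi> _ f])
  then show ?thesis using eq[of f] by (simp add: J_def)
qed

section \<open>Jacobian criterion for algebraic independence\<close>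

definition aindep :: "(nat \<Rightarrow> 'a::comm_ring_1 mpoly) \<Rightarrow> nat set \<Rightarrow> bool" where
  "aindep g I \<longleftrightarrow> (\<forall>f. vars f \<subseteq> I \<longrightarrow> subst g f = 0 \<longrightarrow> f = 0)"

text \<open>Injectivity makes a repeated gradient count as a dependence. Like \<open>aindep\<close>,
  the notion is indexed by a set, so that subfamilies need no renumbering.\<close>

definition lindep :: "(nat \<Rightarrow> 'a::field_char_0 mpoly) \<Rightarrow> nat set \<Rightarrow> bool" where
  "lindep g I \<longleftrightarrow> inj_on (\<lambda>i. grad (emb (g i))) I \<and> gv.vs1.independent ((\<lambda>i. grad (emb (g i))) ` I)"

abbreviation gspan :: "(nat \<Rightarrow> 'a::field_char_0 mpoly) \<Rightarrow> nat set \<Rightarrow> (nat \<Rightarrow> 'a mpoly fract) set" where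
  "gspan g I \<equiv> gv.vs1.span ((\<lambda>i. grad (emb (g i))) ` I)"

lemma lindep_insert: "lindep g I \<Longrightarrow> grad (emb (g j)) \<notin> gspan g I \<Longrightarrow> lindep g (insert j I)"
  unfolding lindep_def
  using gv.vs1.span_base[of "grad (emb (g j))" "(\<lambda>i. grad (emb (g i))) ` I"]
    gv.vs1.independent_insertI[of "grad (emb (g j))" "(\<lambda>i. grad (emb (g i))) ` I"]
  by auto

lemma lindep_functional:
  assumes "lindep g I"
  shows "\<exists>\<phi>. functional \<phi> \<and> (\<forall>i\<in>I. \<phi> (grad (emb (g i))) = p i)"
proof -
  let ?v = "\<lambda>i. grad (emb (g i))"
  obtain \<phi> where "functional \<phi>" "\<forall>x\<in>?v ` I. \<phi> x = p (inv_into I ?v x)"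
    using assms gv.linear_independent_extend[of "?v ` I" "p \<circ> inv_into I ?v"] unfolding lindep_def by auto
  moreover have "inv_into I ?v (?v i) = i" if "i \<in> I" for i
    using assms that inv_into_f_f[of ?v I i] by (simp add: lindep_def)
  ultimately show ?thesis by (intro exI[of _ \<phi>]) simp
qed

text \<open>A derivation dual to \<open>g j\<close> turns a relation \<open>f(g) = 0\<close> into
  the relation given by \<open>pd j f\<close>, which has lower degree and is zero by induction. So
  \<open>f\<close> is constant, and a constant relation is zero.\<close>

lemma lindep_imp_aindep:
  assumes I: "finite I" and li: "lindep g I"
  shows "aindep g I"
  unfolding aindep_def
proof (intro allI impI)
  fix f assume f: "vars f \<subseteq> I" "subst g f = 0"
  obtain d where "deg_lt d f" using deg_lt_exists by blast
  then show "f = 0" using f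
  proof (induction d arbitrary: f)
    case 0
    then show ?case by simp
  next
    case (Suc d)
    have "pd j f = 0" for j
    proof (cases "j \<in> I")
      case True
      obtain \<phi> where \<phi>: "functional \<phi>" "\<forall>i\<in>I. \<phi> (grad (emb (g i))) = (if i = j then 1 else 0)"
        using lindep_functional[OF li, of "\<lambda>i. if i = j then 1 else 0"] by blast
      have "0 = (\<Sum>i\<in>I. emb (subst g (pd i f)) * \<phi> (grad (emb (g i))))"
        using derivation_subst[OF derivation_functional_grad[OF \<phi>(1)] I Suc.prems(2), of g]
          derivation_0[OF derivation_functional_grad[OF \<phi>(1)]]
        by (simp add: Suc.prems(3))
      also have "\<dots> = (\<Sum>i\<in>I. if i = j then emb (subst g (pd j f)) else 0)"
        using \<phi>(2) by (intro sum.cong) auto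
      also have "\<dots> = emb (subst g (pd j f))"
        using I True by simp
      finally have "subst g (pd j f) = 0" by (simp add: emb_eq_0_iff)
      then show ?thesis using Suc.IH[of "pd j f"] Suc.prems vars_pd[of j f] deg_lt_pd by blast
    next
      case False
      then show ?thesis using Suc.prems(2) by (intro pd_eq_0_if_notin_vars) auto
    qed
    then have "vars f = {}" using pd_eq_0_imp_notin_vars by blast
    then obtain c where "f = mconst c" using vars_empty_imp_mconst by blast
    then show ?case using Suc.prems(3) by simp
  qed
qed

text \<open>As long as some partial derivative is a nonzero relation, replace \<open>F\<close> by
  it; the degree drops, so this stops.\<close>

lemma minimal_relation:
  fixes g :: "nat \<Rightarrow> 'a::comm_ring_1 mpoly"
  assumes "F \<noteq> 0" "vars F \<subseteq> I" "subst g F = 0"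
  shows "\<exists>F. F \<noteq> 0 \<and> vars F \<subseteq> I \<and> subst g F = 0 \<and> (\<forall>i. subst g (pd i F) = 0 \<longrightarrow> pd i F = 0)"
proof -
  obtain d where "deg_lt d F" using deg_lt_exists by blast
  then show ?thesis using assms
  proof (induction d arbitrary: F)
    case 0
    then show ?case by simp
  next
    case (Suc d)
    show ?case
    proof (cases "\<exists>i. subst g (pd i F) = 0 \<and> pd i F \<noteq> 0")
      case True
      then obtain i where "subst g (pd i F) = 0" "pd i F \<noteq> 0" by blast
      then show ?thesis using Suc vars_pd[of i F] deg_lt_pd by blast
    next
      case False
      then show ?thesis using Suc by blast
    qed
  qed
qed

lemma lindep_mvar: "lindep (mvar :: nat \<Rightarrow> 'a::field_char_0 mpoly) I"
proof -
  let ?X = "\<lambda>i. grad (emb (mvar i)) :: nat \<Rightarrow> 'a mpoly fract"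
  have X: "?X i l = (if i = l then 1 else 0)" for i l
    by (simp add: grad_emb pd_mvar emb_1)
  have inj: "inj ?X"
    by (rule injI) (metis X zero_neq_one)
  have "?X i \<notin> gv.vs1.span (?X ` I - {?X i})" for i
  proof
    assume *: "?X i \<in> gv.vs1.span (?X ` I - {?X i})"
    have "functional (\<lambda>v. v i)" by (rule functionalI) auto
    from gv.linear_eq_0_on_span[OF this _ *] have "?X i i = 0" using X by force
    then show False by (simp add: X)
  qed
  then have "gv.vs1.independent (?X ` I)"
    unfolding gv.vs1.dependent_def by blast
  with inj show ?thesis unfolding lindep_def by (auto intro: inj_on_subset)
qed

lemma lindep_spanning_subset:
  "\<exists>J\<subseteq>I. lindep g J \<and> (\<lambda>i. grad (emb (g i))) ` I \<subseteq> gspan g J"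
proof -
  let ?v = "\<lambda>i. grad (emb (g i))"
  obtain B where B: "B \<subseteq> ?v ` I" "gv.vs1.independent B" "?v ` I \<subseteq> gv.vs1.span B"
    by (rule gv.vs1.maximal_independent_subset)
  then obtain J where "J \<subseteq> I" "inj_on ?v J" "B = ?v ` J" unfolding subset_image_inj by blast
  with B show ?thesis unfolding lindep_def by blast
qed

text \<open>The half of the Jacobian criterion that fails in positive characteristic. Variables are
  added to the family until its gradients span those of all n variables. Together with
  \<open>g j\<close> there are then more than n polynomials, so a relation exists, and a minimal one
  turns out to avoid the added variables.\<close>

lemma relation_of_grad_in_span:
  assumes I: "finite I" and li: "lindep g I" and j: "grad (emb (g j)) \<in> gspan g I"
    and vars: "\<And>i. i \<in> insert j I \<Longrightarrow> vars (g i) \<subseteq> {..<n}" and jI: "j \<notin> I"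
  shows "\<exists>F. vars F \<subseteq> insert j I \<and> subst g F = 0 \<and> subst g (pd j F) \<noteq> 0"
proof -
  obtain N where N: "insert j I \<subseteq> {..<N}"
    using I finite_nat_set_iff_bounded[of "insert j I"] by auto
  \<comment> \<open>Variables are stored from index \<open>N\<close> on, beyond \<open>j\<close> and
    \<open>I\<close>, so that one family holds both the given polynomials and the added
    variables.\<close>
  define g' where "g' i = (if i < N then g i else mvar (i - N))" for i
  let ?v = "\<lambda>i. grad (emb (g i))" and ?v' = "\<lambda>i. grad (emb (g' i))"
  let ?X = "\<lambda>l. grad (emb (mvar l :: 'a mpoly))"
  obtain B where B: "?v ` I \<subseteq> B" "B \<subseteq> ?v ` I \<union> ?X ` {..<n}" "gv.vs1.independent B"
      "?v ` I \<union> ?X ` {..<n} \<subseteq> gv.vs1.span B"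
    using gv.vs1.maximal_independent_subset_extend[of "?v ` I" "?v ` I \<union> ?X ` {..<n}"] li
    unfolding lindep_def by blast
  have finB: "finite B" using B(2) I by (meson finite_UnI finite_imageI finite_lessThan finite_subset)
  define T where "T = {l. l < n \<and> ?X l \<in> B \<and> ?X l \<notin> ?v ` I}"
  define I' where "I' = I \<union> (+) N ` T"
  have finT: "finite T" by (simp add: T_def)
  then have finI': "finite I'" using I by (simp add: I'_def)
  have v'I: "?v' i = ?v i" if "i \<in> insert j I" for i
    using that N by (auto simp: g'_def)
  have v'T: "?v' (N + l) = ?X l" for l by (simp add: g'_def)
  have im: "?v' ` I' = B"
  proof -
    have "?v' ` I' = ?v ` I \<union> ?X ` T"
      using v'I v'T by (auto simp: I'_def image_Un image_image)
    also have "\<dots> = B" using B(1,2) by (auto simp: T_def)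
    finally show ?thesis .
  qed
  have inj: "inj_on ?v' I'"
  proof -
    have "inj_on ?v' I" using li v'I unfolding lindep_def by (simp add: inj_on_def)
    moreover have "inj_on ?v' ((+) N ` T)"
      using lindep_mvar[where 'a = 'a, of T] unfolding lindep_def by (auto simp: inj_on_def v'T)
    moreover have "?v' ` I \<inter> ?v' ` ((+) N ` T) = {}"
    proof -
      have "?v' ` I = ?v ` I" by (rule image_cong) (auto simp: v'I)
      moreover have "?v' ` ((+) N ` T) = ?X ` T" by (simp add: image_image v'T)
      moreover have "x \<notin> ?v ` I" if "x \<in> ?X ` T" for x
        using that by (elim imageE) (simp only: T_def mem_Collect_eq not_False_eq_True)
      ultimately show ?thesis by blast
    qed
    ultimately show ?thesis unfolding I'_def by (auto simp: inj_on_Un)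
  qed
  have li': "lindep g' I'" using B(3) inj im by (simp add: lindep_def)
  \<comment> \<open>\<open>B\<close> spans the n independent gradients of the variables, so
    \<open>I'\<close> has at least n members and \<open>insert j I'\<close> more than n.\<close>
  have "card (?X ` {..<n}) \<le> card B"
    using gv.vs1.independent_span_bound[OF finB, of "?X ` {..<n}"] B(4) lindep_mvar[where 'a = 'a, of "{..<n}"]
    unfolding lindep_def by auto
  moreover have "card (?X ` {..<n}) = n"
    using lindep_mvar[where 'a = 'a, of "{..<n}"] unfolding lindep_def by (simp add: card_image)
  moreover have "card I' = card B" using inj im card_image by metis
  moreover have jI': "j \<notin> I'" using jI N by (auto simp: I'_def)
  ultimately have card: "n < card (insert j I')" using finI' by simp
  have vars': "vars (g' i) \<subseteq> {..<n}" if "i \<in> insert j I'" for i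
  proof (cases "i \<in> insert j I")
    case True
    then show ?thesis using vars[of i] N by (auto simp: g'_def)
  next
    case False
    then show ?thesis using that by (auto simp: I'_def g'_def T_def)
  qed
  have "\<exists>F. F \<noteq> 0 \<and> vars F \<subseteq> insert j I' \<and> subst g' F = 0"
    using finI' by (intro algebraic_relation_of_card_gt[OF _ card] vars') auto
  then obtain F0 where F0: "F0 \<noteq> 0" "vars F0 \<subseteq> insert j I'" "subst g' F0 = 0"
    by blast
  obtain F where F: "F \<noteq> 0" "vars F \<subseteq> insert j I'" "subst g' F = 0"
      and min: "\<And>i. subst g' (pd i F) = 0 \<Longrightarrow> pd i F = 0"
    using minimal_relation[OF F0] by blast
  \<comment> \<open>The functional dual to the added variable vanishes on the span of
    \<open>I\<close>, hence on the gradient of \<open>g j\<close>. Applied to the relation it leaves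
    only the partial derivative in that variable, which is zero by minimality.\<close>
  have "N + l \<notin> vars F" if l: "l \<in> T" for l
  proof -
    have i: "N + l \<in> I'" "N + l \<notin> I" using l N by (auto simp: I'_def)
    obtain \<phi> where \<phi>: "functional \<phi>" "\<And>i. i \<in> I' \<Longrightarrow> \<phi> (?v' i) = (if i = N + l then 1 else 0)"
      using lindep_functional[OF li', of "\<lambda>i. if i = N + l then 1 else 0"] by blast
    have "\<phi> x = 0" if "x \<in> ?v ` I" for x
      using that \<phi>(2) v'I i(2) by (force simp: I'_def)
    then have "\<phi> (?v j) = 0" by (rule gv.linear_eq_0_on_span[OF \<phi>(1) _ j])
    then have \<phi>j: "\<phi> (?v' j) = 0" using v'I by simp
    have "0 = (\<Sum>i\<in>insert j I'. emb (subst g' (pd i F)) * \<phi> (?v' i))"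
      using derivation_subst[OF derivation_functional_grad[OF \<phi>(1)] _ F(2), of g']
        derivation_0[OF derivation_functional_grad[OF \<phi>(1)]] finI'
      by (simp add: F(3))
    also have "\<dots> = (\<Sum>i\<in>insert j I'. if i = N + l then emb (subst g' (pd (N + l) F)) else 0)"
      using \<phi>(2) \<phi>j jI' i(1) by (intro sum.cong) auto
    also have "\<dots> = emb (subst g' (pd (N + l) F))"
      using finI' i(1) by simp
    finally have "pd (N + l) F = 0" using min by (simp add: emb_eq_0_iff)
    then show ?thesis by (rule pd_eq_0_imp_notin_vars)
  qed
  then have F': "vars F \<subseteq> insert j I" using F(2) by (auto simp: I'_def)
  have same: "subst g' f = subst g f" if "vars f \<subseteq> insert j I" for f
    using that N by (intro subst_cong) (auto simp: g'_def)
  \<comment> \<open>Otherwise \<open>F\<close> would be a nonzero relation among the independent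
    members of \<open>I\<close>.\<close>
  have "pd j F \<noteq> 0"
  proof
    assume "pd j F = 0"
    then have "vars F \<subseteq> I" using F' pd_eq_0_imp_notin_vars by blast
    then have "F = 0" using lindep_imp_aindep[OF I li] same[OF F'] F(3) by (simp add: aindep_def)
    with F(1) show False by simp
  qed
  then have "subst g' (pd j F) \<noteq> 0" using min by blast
  then show ?thesis using F' F(3) same[of F] same[of "pd j F"] vars_pd[of j F] by auto
qed

lemma aindep_imp_lindep:
  assumes "finite I" "aindep g I" "\<And>i. i \<in> I \<Longrightarrow> vars (g i) \<subseteq> {..<n}"
  shows "lindep g I"
  using assms
proof (induction I rule: finite_induct)
  case empty
  then show ?case by (simp add: lindep_def gv.vs1.independent_empty)
next
  case (insert j I)
  have "aindep g I" using insert.prems(1) unfolding aindep_def by blast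
  then have li: "lindep g I" using insert.prems(2) by (intro insert.IH) auto
  show ?case
  proof (rule lindep_insert[OF li], rule notI)
    assume "grad (emb (g j)) \<in> gspan g I"
    then obtain F where F: "vars F \<subseteq> insert j I" "subst g F = 0" "subst g (pd j F) \<noteq> 0"
      using relation_of_grad_in_span[OF insert.hyps(1) li _ insert.prems(2) insert.hyps(2)] by blast
    then have "F = 0" using insert.prems(1) by (simp add: aindep_def)
    with F(3) show False by simp
  qed
qed

lemma aindep_iff_lindep:
  assumes "finite I" "\<And>i. i \<in> I \<Longrightarrow> vars (g i) \<subseteq> {..<n}"
  shows "aindep g I \<longleftrightarrow> lindep g I"
  using assms aindep_imp_lindep lindep_imp_aindep by blast

text \<open>First-order compatibility with the relations suffices for a derivation with prescribed
  values. Polynomials are added one at a time: if the gradient of \<open>g j\<close> is new, a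
  separating functional corrects the value at \<open>j\<close>; if not, a relation with nonzero
  partial derivative at \<open>j\<close> forces that value to be \<open>p j\<close>.\<close>

lemma functional_of_relations:
  fixes g :: "nat \<Rightarrow> 'a::field_char_0 mpoly"
  assumes "finite I" and "\<And>i. i \<in> I \<Longrightarrow> vars (g i) \<subseteq> {..<n}"
    and "\<And>f. vars f \<subseteq> I \<Longrightarrow> subst g f = 0 \<Longrightarrow> (\<Sum>i\<in>I. emb (subst g (pd i f)) * p i) = 0"
  shows "\<exists>\<phi>. functional \<phi> \<and> (\<forall>i\<in>I. \<phi> (grad (emb (g i))) = p i)"
  using assms
proof (induction I rule: finite_induct)
  case empty
  show ?case using gv.linear_zero by blast
next
  case (insert j I)
  let ?v = "\<lambda>i. grad (emb (g i))"
  have "(\<Sum>i\<in>I. emb (subst g (pd i f)) * p i) = 0" if f: "vars f \<subseteq> I" "subst g f = 0" for f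
  proof -
    have "j \<notin> vars f" using f(1) insert.hyps(2) by blast
    then have "pd j f = 0" by (rule pd_eq_0_if_notin_vars)
    then show ?thesis using insert.prems(2)[of f] f insert.hyps by auto
  qed
  then obtain \<phi> where \<phi>: "functional \<phi>" "\<forall>i\<in>I. \<phi> (?v i) = p i"
    using insert.IH insert.prems(1) by auto
  show ?case
  proof (cases "?v j \<in> gspan g I")
    case False
    then obtain \<psi> where \<psi>: "functional \<psi>" "\<psi> (?v j) = 1" "\<And>x. x \<in> gspan g I \<Longrightarrow> \<psi> x = 0"
      using functional_separating_span by blast
    let ?\<phi> = "\<lambda>x. \<phi> x + (p j - \<phi> (?v j)) * \<psi> x"
    have "functional ?\<phi>"
      by (intro gv.linear_compose_add gv.linear_compose_scale_right \<phi>(1) \<psi>(1))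
    moreover have "\<psi> (?v i) = 0" if "i \<in> I" for i
      using that by (intro \<psi>(3) gv.vs1.span_base) auto
    ultimately show ?thesis using \<phi>(2) \<psi>(2) by (intro exI[of _ ?\<phi>]) auto
  next
    case True
    \<comment> \<open>The relation lemma needs independent gradients, so \<open>I\<close> is
      replaced by a maximal independent subfamily with the same span.\<close>
    obtain J where J: "J \<subseteq> I" "lindep g J" "?v ` I \<subseteq> gspan g J" using lindep_spanning_subset[of I g] by blast
    have "?v j \<in> gspan g J"
      using True gv.vs1.span_minimal[OF J(3) gv.vs1.subspace_span] by blast
    moreover have "finite J" "j \<notin> J" using J(1) insert.hyps finite_subset by auto
    ultimately obtain F where F: "vars F \<subseteq> insert j J" "subst g F = 0" "subst g (pd j F) \<noteq> 0"
      using relation_of_grad_in_span[OF _ J(2), of j n] insert.prems(1) J(1) by blast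
    have varsF: "vars F \<subseteq> insert j I" using F(1) J(1) by blast
    have "0 = (\<Sum>i\<in>insert j I. emb (subst g (pd i F)) * \<phi> (?v i))"
      using derivation_subst[OF derivation_functional_grad[OF \<phi>(1)] _ varsF, of g]
        derivation_0[OF derivation_functional_grad[OF \<phi>(1)]] insert.hyps(1)
      by (simp add: F(2))
    also have "\<dots> = emb (subst g (pd j F)) * \<phi> (?v j) + (\<Sum>i\<in>I. emb (subst g (pd i F)) * p i)"
      using insert.hyps \<phi>(2) by simp
    finally have "emb (subst g (pd j F)) * \<phi> (?v j) = emb (subst g (pd j F)) * p j"
      using insert.prems(2)[OF varsF F(2)] insert.hyps by (simp add: add_eq_0_iff2)
    then have "\<phi> (?v j) = p j" using F(3) by (simp add: emb_eq_0_iff)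
    then show ?thesis using \<phi> by blast
  qed
qed

subsection \<open>Image apices and derivations\<close>

lemma derivation_add_derivation:
  assumes "derivation D" "derivation E"
  shows "derivation (\<lambda>x. D x + E x)"
  using assms by (simp add: derivation_def algebra_simps)

lemma derivation_eq_0_of_gspan:
  assumes "derivation D" "finite I" "\<And>i. i \<in> I \<Longrightarrow> D (emb (g i)) = 0" "grad (emb f) \<in> gspan g I"
  shows "D (emb f) = 0"
proof (rule derivation_eq_0_of_grad_in_span[OF assms(1)])
  show "finite (g ` I)" using assms(2) by simp
  show "D (emb p) = 0" if "p \<in> g ` I" for p using that assms(3) by blast
  show "grad (emb f) \<in> gv.vs1.span ((\<lambda>g. grad (emb g)) ` g ` I)"
    using assms(4) by (simp add: image_image)
qed

text \<open>If a derivation \<open>Y\<close> kills the \<open>g i\<close>, so does \<open>[Y, D]\<close>, because \<open>D (g i)\<close> is constant.\<close>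

lemma grad_derivation_in_gspan:
  assumes D: "derivation D" and I: "finite I"
    and const: "\<And>i. i \<in> I \<Longrightarrow> \<exists>c. D (emb (g i)) = emb (mconst c)"
    and f: "grad (emb f) \<in> gspan g I"
  shows "grad (D (emb f)) \<in> gspan g I"
proof (rule ccontr)
  assume "\<not> ?thesis"
  then obtain \<phi> where \<phi>: "functional \<phi>" "\<phi> (grad (D (emb f))) = 1" "\<And>x. x \<in> gspan g I \<Longrightarrow> \<phi> x = 0"
    using functional_separating_span[of "grad (D (emb f))"] by blast
  let ?Y = "\<lambda>x. \<phi> (grad x)"
  have Y: "derivation ?Y" by (rule derivation_functional_grad[OF \<phi>(1)])
  have "?Y (D (emb f)) - D (?Y (emb f)) = 0"
  proof (rule derivation_eq_0_of_gspan[OF derivation_commutator[OF Y D] I _ f])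
    fix i assume i: "i \<in> I"
    obtain c where c: "D (emb (g i)) = emb (mconst c)" using const[OF i] by blast
    have "?Y (emb (g i)) = 0" using i by (intro \<phi>(3) gv.vs1.span_base) auto
    then show "?Y (D (emb (g i))) - D (?Y (emb (g i))) = 0"
      by (simp add: c derivation_mconst[OF Y] derivation_0[OF D])
  qed
  moreover have "?Y (emb f) = 0" by (rule \<phi>(3)[OF f])
  ultimately show False using \<phi>(2) by (simp add: derivation_0[OF D])
qed

text \<open>The derivation \<open>[D, E] + D\<close> kills every \<open>g i\<close>, hence also
  \<open>f\<close>. Since \<open>E f = b - f\<close>, its value at \<open>f\<close> is
  \<open>- E (D f)\<close>.\<close>

lemma euler_derivation_eq_0:
  assumes D: "derivation D" and E: "derivation E" and I: "finite I"
    and const: "\<And>i. i \<in> I \<Longrightarrow> \<exists>c. D (emb (g i)) = emb (mconst c)"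
    and euler: "\<And>i. i \<in> I \<Longrightarrow> E (emb (g i)) = emb (mconst (a i)) - emb (g i)"
    and f: "grad (emb f) \<in> gspan g I" "E (emb f) = emb (mconst b) - emb f"
  shows "E (D (emb f)) = 0"
proof -
  let ?F = "\<lambda>x. (D (E x) - E (D x)) + D x"
  have "?F (emb f) = 0"
  proof (rule derivation_eq_0_of_gspan[OF derivation_add_derivation[OF derivation_commutator[OF D E] D] I _ f(1)])
    fix i assume i: "i \<in> I"
    obtain c where c: "D (emb (g i)) = emb (mconst c)" using const[OF i] by blast
    show "?F (emb (g i)) = 0"
      unfolding euler[OF i] derivation_diff[OF D] c derivation_mconst[OF D] derivation_mconst[OF E] by simp
  qed
  then show ?thesis
    unfolding f(2) derivation_diff[OF D] derivation_mconst[OF D] by simp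
qed

text \<open>Expand \<open>x\<close> over \<open>A\<close>. For an index in \<open>A\<close> outside
  \<open>B\<close>, the dual functional vanishes on the span of \<open>B\<close>, so the coefficient
  there is zero.\<close>

lemma gspan_Int:
  assumes S: "lindep g S" "A \<subseteq> S" "B \<subseteq> S" and A: "finite A"
    and x: "x \<in> gspan g A" "x \<in> gspan g B"
  shows "x \<in> gspan g (A \<inter> B)"
proof -
  let ?v = "\<lambda>i. grad (emb (g i))"
  have inj: "inj_on ?v A" using S(1,2) by (auto simp: lindep_def intro: inj_on_subset)
  obtain u where "x = (\<Sum>w\<in>?v ` A. sc (u w) w)"
    using x(1) A gv.vs1.span_finite[of "?v ` A"] by auto
  then have u: "x = (\<Sum>a\<in>A. sc (u (?v a)) (?v a))"
    by (simp add: sum.reindex[OF inj])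
  have "u (?v a) = 0" if a: "a \<in> A" "a \<notin> B" for a
  proof -
    obtain \<phi> where \<phi>: "functional \<phi>" "\<forall>i\<in>S. \<phi> (?v i) = (if i = a then 1 else 0)"
      using lindep_functional[OF S(1), of "\<lambda>i. if i = a then 1 else 0"] by blast
    have "\<phi> y = 0" if "y \<in> ?v ` B" for y using that \<phi>(2) a(2) S(3) by auto
    then have "0 = \<phi> x" by (rule gv.linear_eq_0_on_span[OF \<phi>(1) _ x(2), symmetric])
    also have "\<dots> = (\<Sum>i\<in>A. u (?v i) * \<phi> (?v i))"
      unfolding u gv.linear_sum[OF \<phi>(1)] functional_scale[OF \<phi>(1)] ..
    also have "\<dots> = (\<Sum>i\<in>A. if i = a then u (?v a) else 0)"
      using \<phi>(2) S(2) by (intro sum.cong) auto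
    also have "\<dots> = u (?v a)" using A a by simp
    finally show ?thesis by simp
  qed
  then have "x = (\<Sum>a\<in>A \<inter> B. sc (u (?v a)) (?v a))"
    unfolding u by (intro sum.mono_neutral_right) (auto simp: A fun_eq_iff)
  moreover have "\<dots> \<in> gspan g (A \<inter> B)"
    by (intro gv.vs1.span_sum gv.vs1.span_scale gv.vs1.span_base) auto
  ultimately show ?thesis by simp
qed

text \<open>Differentiating \<open>f(G + t p) = 0\<close> at t = 0 gives exactly the compatibility
  that \<open>functional_of_relations\<close> asks for; \<open>G\<close> is free of t, so setting t
  = 0 recovers it.\<close>

lemma proj_image_apex_functional:
  fixes G :: "'a::field_char_0 mpoly list"
  assumes p: "proj_image_apex n G p" and G: "\<And>i. i < length G \<Longrightarrow> vars (G ! i) \<subseteq> {..<n}"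
  shows "\<exists>\<phi>. functional \<phi> \<and> (\<forall>i<length G. \<phi> (grad (emb (G ! i))) = emb (mconst (p ! i)))"
proof -
  have "\<exists>\<phi>. functional \<phi> \<and> (\<forall>i\<in>{..<length G}. \<phi> (grad (emb (G ! i))) = emb (mconst (p ! i)))"
  proof (rule functional_of_relations)
    fix f assume f: "vars f \<subseteq> {..<length G}" "subst ((!) G) f = 0"
    then have 0: "subst (\<lambda>i. G ! i + mvar n * mconst (p ! i)) f = 0"
      using p by (simp add: proj_image_apex_def)
    have fresh: "n \<notin> vars (G ! i)" if "i < length G" for i using G[OF that] by auto
    have "(\<Sum>i<length G. subst ((!) G) (pd i f) * mconst (p ! i)) = 0"
      by (rule sum_pd_eq_0_of_subst_eq_0[OF _ f(1) 0, where \<tau> = "mvar(n := 0)" and n = n])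
        (simp_all add: fresh subst_add subst_mult subst_mvar_upd_fresh pd_add pd_mult pd_mvar pd_eq_0_if_notin_vars)
    then show "(\<Sum>i<length G. emb (subst ((!) G) (pd i f)) * emb (mconst (p ! i))) = 0"
      by (simp only: emb_sum [symmetric] emb_mult [symmetric] emb_0)
  qed (use G in auto)
  then show ?thesis by auto
qed

text \<open>The same at t = 0 for the segment from \<open>G\<close> to \<open>a\<close>, whose
  velocity is \<open>a - G\<close>: up to sign, the Euler derivation centred at
  \<open>a\<close>.\<close>

lemma image_apex_functional:
  fixes G :: "'a::field_char_0 mpoly list"
  assumes a: "image_apex n G a" and G: "\<And>i. i < length G \<Longrightarrow> vars (G ! i) \<subseteq> {..<n}"
  shows "\<exists>\<phi>. functional \<phi> \<and> (\<forall>i<length G. \<phi> (grad (emb (G ! i))) = emb (mconst (a ! i)) - emb (G ! i))"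
proof -
  have "\<exists>\<phi>. functional \<phi> \<and> (\<forall>i\<in>{..<length G}. \<phi> (grad (emb (G ! i))) = emb (mconst (a ! i) - G ! i))"
  proof (rule functional_of_relations)
    fix f assume f: "vars f \<subseteq> {..<length G}" "subst ((!) G) f = 0"
    then have 0: "subst (\<lambda>i. (1 - mvar n) * G ! i + mvar n * mconst (a ! i)) f = 0"
      using a by (simp add: image_apex_def)
    have fresh: "n \<notin> vars (G ! i)" if "i < length G" for i using G[OF that] by auto
    have "(\<Sum>i<length G. subst ((!) G) (pd i f) * (mconst (a ! i) - G ! i)) = 0"
      by (rule sum_pd_eq_0_of_subst_eq_0[OF _ f(1) 0, where \<tau> = "mvar(n := 0)" and n = n])
        (simp_all add: fresh subst_add subst_diff subst_uminus subst_mult subst_mvar_upd_fresh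
          pd_add pd_diff pd_mult pd_mvar pd_eq_0_if_notin_vars)
    then show "(\<Sum>i<length G. emb (subst ((!) G) (pd i f)) * emb (mconst (a ! i) - G ! i)) = 0"
      by (simp only: emb_sum [symmetric] emb_mult [symmetric] emb_0)
  qed (use G in auto)
  then show ?thesis by auto
qed

text \<open>Applying \<open>D\<close> to any relation gives the first-order condition in direction
  \<open>p\<close>, and \<open>subst_translate_eq_0\<close> integrates it.\<close>

lemma proj_image_apexI:
  fixes G :: "'a::field_char_0 mpoly list"
  assumes D: "derivation D" and DG: "\<And>i. i < length G \<Longrightarrow> D (emb (G ! i)) = emb (mconst (p ! i))"
    and G: "\<And>i. i < length G \<Longrightarrow> vars (G ! i) \<subseteq> {..<n}"
    and p: "length p = length G" "p \<noteq> replicate (length G) 0"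
  shows "proj_image_apex n G p"
  unfolding proj_image_apex_def
proof (intro conjI allI impI p)
  fix f assume f: "vars f \<subseteq> {..<length G}" "subst ((!) G) f = 0"
  show "subst (\<lambda>i. G ! i + mvar n * mconst (p ! i)) f = 0"
  proof (rule subst_translate_eq_0[OF _ _ _ f])
    show "n \<notin> vars (G ! i)" if "i \<in> {..<length G}" for i using G that by auto
    fix f' assume f': "vars f' \<subseteq> {..<length G}" "subst ((!) G) f' = 0"
    have "0 = (\<Sum>j<length G. emb (subst ((!) G) (pd j f')) * D (emb (G ! j)))"
      using derivation_subst[OF D _ f'(1), of "(!) G"] by (simp add: f'(2) derivation_0[OF D])
    also have "\<dots> = (\<Sum>j<length G. emb (subst ((!) G) (pd j f')) * emb (mconst (p ! j)))"
      by (intro sum.cong) (auto simp: DG)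
    also have "\<dots> = emb (\<Sum>j<length G. subst ((!) G) (pd j f') * mconst (p ! j))"
      by (simp only: emb_sum emb_mult)
    finally show "(\<Sum>j<length G. subst ((!) G) (pd j f') * mconst (p ! j)) = 0"
      by (rule emb_eq_0_iff[THEN iffD1, OF sym])
  qed simp
qed

text \<open>The constant values of \<open>D\<close> on the block would form an apex of it if one of
  them were nonzero.\<close>

lemma derivation_eq_0_of_no_apex:
  fixes H :: "'a::field_char_0 mpoly list"
  assumes no: "\<not> (\<exists>p. proj_image_apex n (take (b - a) (drop a H)) p)" and b: "b \<le> length H"
    and H: "\<And>i. i < length H \<Longrightarrow> vars (H ! i) \<subseteq> {..<n}"
    and D: "derivation D" and const: "\<And>i. a \<le> i \<Longrightarrow> i < b \<Longrightarrow> \<exists>c. D (emb (H ! i)) = emb (mconst c)"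
    and i: "a \<le> i" "i < b"
  shows "D (emb (H ! i)) = 0"
proof -
  let ?G = "take (b - a) (drop a H)"
  have len: "length ?G = b - a" using b by simp
  have nth: "?G ! j = H ! (a + j)" if "j < b - a" for j using that b by simp
  obtain c where c: "\<And>i. a \<le> i \<Longrightarrow> i < b \<Longrightarrow> D (emb (H ! i)) = emb (mconst (c i))"
    using const by metis
  let ?p = "map (\<lambda>j. c (a + j)) [0..<b - a]"
  have "?p = replicate (b - a) 0"
  proof (rule ccontr)
    assume "?p \<noteq> replicate (b - a) 0"
    then have "proj_image_apex n ?G ?p"
      using H b by (intro proj_image_apexI[OF D]) (simp_all add: len nth c)
    with no show False by blast
  qed
  then have "?p ! (i - a) = replicate (b - a) 0 ! (i - a)" by (rule arg_cong)
  then have "c i = 0" using i diff_less_mono[OF i(2,1)] by simp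
  then show ?thesis using c[OF i] by simp
qed

text \<open>Otherwise a functional that is 1 on the gradient of \<open>H ! j\<close> and 0 on the
  others makes a unit vector an apex of the block.\<close>

lemma grad_in_gspan_of_no_apex:
  fixes H :: "'a::field_char_0 mpoly list"
  assumes no: "\<not> (\<exists>p. proj_image_apex n (take (b - a) (drop a H)) p)" and b: "b \<le> length H"
    and H: "\<And>i. i < length H \<Longrightarrow> vars (H ! i) \<subseteq> {..<n}" and j: "a \<le> j" "j < b"
  shows "grad (emb (H ! j)) \<in> gspan ((!) H) ({a..<b} - {j})"
proof (rule ccontr)
  assume "\<not> ?thesis"
  then obtain \<phi> where \<phi>: "functional \<phi>" "\<phi> (grad (emb (H ! j))) = 1"
      "\<And>x. x \<in> gspan ((!) H) ({a..<b} - {j}) \<Longrightarrow> \<phi> x = 0"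
    using functional_separating_span[of "grad (emb (H ! j))"] by blast
  have "\<exists>c. \<phi> (grad (emb (H ! i))) = emb (mconst c)" if "a \<le> i" "i < b" for i
  proof (cases "i = j")
    case True
    then show ?thesis using \<phi>(2) by (intro exI[of _ 1]) (simp add: emb_1)
  next
    case False
    then have "\<phi> (grad (emb (H ! i))) = 0"
      using that by (intro \<phi>(3) gv.vs1.span_base) auto
    then show ?thesis by (intro exI[of _ 0]) simp
  qed
  from derivation_eq_0_of_no_apex[OF no b H derivation_functional_grad[OF \<phi>(1)] this j]
  have "\<phi> (grad (emb (H ! j))) = 0" by simp
  with \<phi>(2) show False by simp
qed

section \<open>Transcendence degree computed from gradients\<close>

lemma lindep_cong: "(\<And>i. i \<in> I \<Longrightarrow> g i = g' i) \<Longrightarrow> lindep g I = lindep g' I"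
  unfolding lindep_def by (intro conj_cong inj_on_cong arg_cong[where f = "\<lambda>X. gv.vs1.independent X"] image_cong refl) auto

lemma lindep_reindex:
  assumes "bij_betw \<sigma> I S"
  shows "lindep (\<lambda>i. g (\<sigma> i)) I \<longleftrightarrow> lindep g S"
proof -
  have "inj_on \<sigma> I" "\<sigma> ` I = S" using assms by (auto simp: bij_betw_def)
  then show ?thesis
    using comp_inj_on_iff[of \<sigma> I "\<lambda>i. grad (emb (g i))"]
      image_comp[of "\<lambda>i. grad (emb (g i))" \<sigma> I]
    unfolding lindep_def by (auto simp: comp_def)
qed

lemma alg_indep_map_iff_lindep:
  fixes H :: "'a::field_char_0 mpoly list"
  assumes H: "\<And>i. i < length H \<Longrightarrow> vars (H ! i) \<subseteq> {..<n}" and S: "S \<subseteq> {..<length H}"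
  shows "alg_indep (map ((!) H) (sorted_list_of_set S)) \<longleftrightarrow> lindep ((!) H) S"
proof -
  let ?l = "sorted_list_of_set S" and ?G = "map ((!) H) (sorted_list_of_set S)"
  have fin: "finite S" using S finite_subset by blast
  have bij: "bij_betw ((!) ?l) {..<length ?l} S"
    using fin bij_betw_nth[of ?l "{..<length ?l}" S] by simp
  then have "vars (?G ! i) \<subseteq> {..<n}" if "i < length ?G" for i
    using that H S by (auto simp: bij_betw_def)
  then have "alg_indep ?G \<longleftrightarrow> lindep ((!) ?G) {..<length ?G}"
    using aindep_iff_lindep[of "{..<length ?G}" "(!) ?G" n] unfolding aindep_def alg_indep_def by auto
  also have "\<dots> \<longleftrightarrow> lindep (\<lambda>i. H ! (?l ! i)) {..<length ?l}"
    by (simp, intro lindep_cong) simp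
  also have "\<dots> \<longleftrightarrow> lindep ((!) H) S"
    using lindep_reindex[OF bij] .
  finally show ?thesis .
qed

text \<open>Independent subfamilies correspond to independent gradients in the span of
  \<open>J\<close>, so their sizes are at most \<open>card J\<close>. This bound makes the set under
  \<open>Max\<close> finite, and \<open>J\<close> attains it.\<close>

lemma trdeg_eq_card_basis:
  fixes H :: "'a::field_char_0 mpoly list"
  assumes H: "\<And>i. i < length H \<Longrightarrow> vars (H ! i) \<subseteq> {..<n}"
    and J: "J \<subseteq> {..<length H}" "lindep ((!) H) J"
    and span: "\<And>i. i < length H \<Longrightarrow> grad (emb (H ! i)) \<in> gspan ((!) H) J"
  shows "trdeg H = card J"
proof -
  let ?v = "\<lambda>i. grad (emb (H ! i))"
  have finJ: "finite J" using J(1) finite_subset by blast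
  have "card S \<le> card J" if S: "S \<subseteq> {..<length H}" "lindep ((!) H) S" for S
  proof -
    have "card (?v ` S) \<le> card (?v ` J)"
      using S span finJ unfolding lindep_def
      by (intro gv.vs1.independent_span_bound[THEN conjunct2]) auto
    then show ?thesis using J(2) S(2) by (simp add: lindep_def card_image)
  qed
  then show ?thesis
    unfolding trdeg_def using J alg_indep_map_iff_lindep[OF H]
    by (intro Max_eqI) (auto intro: finite_subset[of _ "{..card J}"])
qed

text \<open>The crux for two blocks \<open>A\<close> and \<open>B\<close> of an independent family.
  In the second alternative the blocks share one index and \<open>\<phi>\<close> gives the Euler
  derivation of the image apex.\<close>

lemma derivation_const_of_sum_const:
  assumes S: "lindep g S" "finite S" "A \<subseteq> S" "B \<subseteq> S"
    and f1: "grad (emb f1) \<in> gspan g A" and f2: "grad (emb f2) \<in> gspan g B"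
    and D: "derivation D" and const: "\<And>i. i \<in> S \<Longrightarrow> \<exists>c. D (emb (g i)) = emb (mconst c)"
    and sum: "D (emb f1) + D (emb f2) = emb (mconst c)"
    and AB: "A \<inter> B = {} \<or> (\<exists>j \<phi> a b. A \<inter> B = {j} \<and> functional \<phi> \<and>
      (\<forall>i\<in>A. \<phi> (grad (emb (g i))) = emb (mconst (a i)) - emb (g i)) \<and>
      \<phi> (grad (emb f1)) = emb (mconst b) - emb f1)"
  shows "\<exists>c. D (emb f1) = emb (mconst c)"
proof (rule grad_eq_0_imp_mconst)
  let ?x = "grad (D (emb f1))"
  have fin: "finite A" "finite B" using S finite_subset by blast+
  have xA: "?x \<in> gspan g A"
    using const S(3) by (intro grad_derivation_in_gspan[OF D fin(1) _ f1]) auto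
  have "grad (D (emb f2)) \<in> gspan g B"
    using const S(4) by (intro grad_derivation_in_gspan[OF D fin(2) _ f2]) auto
  moreover have "?x + grad (D (emb f2)) = 0"
    by (simp only: grad_add [symmetric] sum grad_mconst)
  then have "?x = - grad (D (emb f2))" by (simp only: eq_neg_iff_add_eq_0)
  ultimately have "?x \<in> gspan g B" by (simp only: gv.vs1.span_neg)
  then have x: "?x \<in> gspan g (A \<inter> B)"
    by (rule gspan_Int[OF S(1) S(3,4) fin(1) xA])
  from AB show "?x = 0"
  proof (elim disjE exE conjE)
    assume "A \<inter> B = {}"
    then show ?thesis using x by simp
  next
    fix j \<phi> a b
    assume j: "A \<inter> B = {j}" and \<phi>: "functional \<phi>"
      and a: "\<forall>i\<in>A. \<phi> (grad (emb (g i))) = emb (mconst (a i)) - emb (g i)"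
      and b: "\<phi> (grad (emb f1)) = emb (mconst b) - emb f1"
    obtain d where d: "?x = sc d (grad (emb (g j)))"
      using x unfolding j by (auto simp: gv.vs1.span_singleton)
    have "0 = \<phi> ?x"
      using const S(3) a b
      by (intro euler_derivation_eq_0[OF D derivation_functional_grad[OF \<phi>] fin(1) _ _ f1, symmetric]) auto
    also have "\<dots> = d * \<phi> (grad (emb (g j)))"
      unfolding d by (rule functional_scale[OF \<phi>])
    also have "\<phi> (grad (emb (g j))) = emb (mconst (a j)) - emb (g j)" using a j by blast
    \<comment> \<open>Either the coefficient \<open>d\<close> is zero or \<open>g j\<close> is
      constant and has zero gradient; in both cases the gradient of \<open>D f1\<close>
      vanishes.\<close>
    finally have "d = 0 \<or> emb (g j) = emb (mconst (a j))" by (metis mult_eq_0_iff right_minus_eq)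
    moreover have "grad (emb (g j)) = 0" if "emb (g j) = emb (mconst (a j))"
      unfolding that by (rule grad_mconst)
    ultimately show ?thesis unfolding d by (auto simp: fun_eq_iff)
  qed
qed

section \<open>Projective image apices of \<open>H\<close> and \<open>h\<close>, and their
  pairing\<close>

theorem theorem5p2:
  fixes H :: "'a::field_char_0 mpoly list" and n M s k :: nat
  assumes HM: "length H = M"
    and Hx: "\<forall>i<M. vars (H ! i) \<subseteq> {..<n}"
    and tr: "trdeg H = M - 2"
    and sk: "s < k" and kM: "k < M"
    and noapex1: "\<not> (\<exists>p. proj_image_apex n (take (k - s) (drop s H)) p)"
    and alt: "(\<not> (\<exists>p. proj_image_apex n (drop k H) p)) \<or>
              ((\<not> (\<exists>p. proj_image_apex n (drop (k - 1) H) p)) \<and> (\<exists>a. image_apex n H a))"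
  defines "h \<equiv> take s H @ [H ! s + H ! (M - 1)] @ take (M - 2 - s) (drop (s + 1) H)"
  shows "{p. proj_image_apex n H p} = span_e_nonzero M s
       \<and> {q. proj_image_apex n h q} = span_e_nonzero (M - 1) s
       \<and> (\<exists>B. dB_paired n h H B id_mat
             \<and> (\<forall>q. proj_image_apex n h q \<longrightarrow>
                    (\<exists>Q. proj_image_apex n H Q \<and> q = mat_vec (M - 1) B Q)))"
proof -
  let ?g = "(!) H" and ?v = "\<lambda>i. grad (emb (H ! i))"
  \<comment> \<open>Indices are zero-based: \<open>s\<close> and \<open>M - 1\<close> belong to the
    two components merged in \<open>h\<close>. The other \<open>M - 2\<close> form the transcendence
    basis.\<close>
  define S where "S = {..<M} - {s, M - 1}"
  \<comment> \<open>The second block starts at \<open>k\<close> in case (i) and at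
    \<open>k - 1\<close> in case (ii).\<close>
  define l where "l = (if \<exists>p. proj_image_apex n (drop k H) p then k - 1 else k)"
  have l: "s \<le> l" "l < M" "k - 1 \<le> l" "l \<le> k" using sk kM by (auto simp: l_def)
  have noapex2: "\<not> (\<exists>p. proj_image_apex n (take (M - l) (drop l H)) p)"
    using alt HM by (auto simp: l_def)
  have V: "vars (H ! i) \<subseteq> {..<n}" if "i < length H" for i using Hx HM that by simp
  have finS: "finite S" and cardS: "card S = M - 2"
    using sk kM by (auto simp: S_def card_Diff_subset)
  have zero1: "D (emb (H ! i)) = 0"
    if "derivation D" "\<And>i. s \<le> i \<Longrightarrow> i < k \<Longrightarrow> \<exists>c. D (emb (H ! i)) = emb (mconst c)" "s \<le> i" "i < k" for D i
    using kM HM that by (intro derivation_eq_0_of_no_apex[OF noapex1 _ V]) auto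
  have zero2: "D (emb (H ! i)) = 0"
    if "derivation D" "\<And>i. l \<le> i \<Longrightarrow> i < M \<Longrightarrow> \<exists>c. D (emb (H ! i)) = emb (mconst c)" "l \<le> i" "i < M" for D i
    using HM that by (intro derivation_eq_0_of_no_apex[OF noapex2 _ V]) auto
  \<comment> \<open>As \<open>l <= k\<close>, the two blocks cover all indices from \<open>s\<close>
    on.\<close>
  have zero: "D (emb (H ! i)) = 0"
    if "derivation D" "\<And>i. s \<le> i \<Longrightarrow> i < M \<Longrightarrow> \<exists>c. D (emb (H ! i)) = emb (mconst c)" "s \<le> i" "i < M" for D i
    using zero1[of D i] zero2[of D i] that l kM by (cases "i < k") auto

  have "{s..<k} - {s} = {s+1..<k}" by auto
  then have span_s: "?v s \<in> gspan ?g {s+1..<k}"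
    using grad_in_gspan_of_no_apex[OF noapex1 _ V, of s] sk kM HM by simp
  have "{l..<M} - {M - 1} = {l..<M - 1}" by auto
  then have span_M: "?v (M - 1) \<in> gspan ?g {l..<M - 1}"
    using grad_in_gspan_of_no_apex[OF noapex2 _ V, of "M - 1"] l HM by simp
  have A: "{s+1..<k} \<subseteq> S" using kM by (auto simp: S_def)
  then have span_sS: "?v s \<in> gspan ?g S"
    using span_s gv.vs1.span_mono[OF image_mono] by blast
  have baseS: "?v i \<in> gspan ?g S" if "i \<in> S" for i
    using that by (intro gv.vs1.span_base) auto
  \<comment> \<open>If \<open>l = s\<close>, the second block contains \<open>s\<close> itself,
    which is not in \<open>S\<close>; so the gradient at \<open>s\<close> is expressed through
    \<open>S\<close> before the one at \<open>M - 1\<close>.\<close>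
  have "?v i \<in> gspan ?g S" if "i < M - 1" for i
    using that span_sS baseS[of i] by (cases "i = s") (simp_all add: S_def)
  then have "?v ` {l..<M - 1} \<subseteq> gspan ?g S" by auto
  then have span_MS: "?v (M - 1) \<in> gspan ?g S"
    using span_M gv.vs1.span_minimal[OF _ gv.vs1.subspace_span] by blast
  have spanS: "?v i \<in> gspan ?g S" if "i < M" for i
    using that span_sS span_MS baseS[of i] by (cases "i \<in> S") (auto simp: S_def)
  \<comment> \<open>A maximal independent subset of \<open>S\<close> spans all gradients, so its
    size is the transcendence degree \<open>M - 2\<close>, which is already the size of
    \<open>S\<close>.\<close>
  have liS: "lindep ?g S"
  proof -
    obtain J where J: "J \<subseteq> S" "lindep ?g J" "?v ` S \<subseteq> gspan ?g J"
      using lindep_spanning_subset[of S ?g] by blast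
    have "?v i \<in> gspan ?g J" if "i < length H" for i
      using spanS[of i] that HM gv.vs1.span_minimal[OF J(3) gv.vs1.subspace_span] by blast
    moreover have "J \<subseteq> {..<length H}" using J(1) HM by (auto simp: S_def)
    ultimately have "trdeg H = card J" using trdeg_eq_card_basis[OF V _ J(2)] by blast
    then have "J = S" using tr cardS J(1) finS by (intro card_subset_eq) auto
    then show ?thesis using J(2) by simp
  qed

  \<comment> \<open>Values are free on the first \<open>s\<close> components and zero on the rest of
    \<open>S\<close>. The first block then forces zero at \<open>s\<close>, after which the second
    block forces zero at \<open>M - 1\<close>.\<close>
  have extend: "\<exists>\<phi>. functional \<phi> \<and> (\<forall>i<s. \<phi> (?v i) = emb (mconst (c i))) \<and> (\<forall>i. s \<le> i \<longrightarrow> i < M \<longrightarrow> \<phi> (?v i) = 0)"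
    for c :: "nat \<Rightarrow> 'a"
  proof -
    obtain \<phi> where \<phi>: "functional \<phi>" "\<forall>i\<in>S. \<phi> (?v i) = (if i < s then emb (mconst (c i)) else 0)"
      using lindep_functional[OF liS, of "\<lambda>i. if i < s then emb (mconst (c i)) else 0"] by blast
    have "\<phi> x = 0" if "x \<in> ?v ` {s+1..<k}" for x
      using that \<phi>(2) kM by (auto simp: S_def)
    then have s: "\<phi> (?v s) = 0" by (rule gv.linear_eq_0_on_span[OF \<phi>(1) _ span_s])
    have "\<phi> x = 0" if x: "x \<in> ?v ` {l..<M - 1}" for x
    proof -
      obtain i where i: "x = ?v i" "l \<le> i" "i < M - 1" using x by auto
      then show ?thesis using s \<phi>(2) l by (cases "i = s") (auto simp: S_def)
    qed
    then have M: "\<phi> (?v (M - 1)) = 0" by (rule gv.linear_eq_0_on_span[OF \<phi>(1) _ span_M])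
    have "\<phi> (?v i) = 0" if "s \<le> i" "i < M" for i
      using that s M \<phi>(2) by (cases "i \<in> S") (auto simp: S_def)
    moreover have "\<phi> (?v i) = emb (mconst (c i))" if "i < s" for i
      using that \<phi>(2) sk kM by (auto simp: S_def)
    ultimately show ?thesis using \<phi>(1) by blast
  qed

  have apexH: "{p. proj_image_apex n H p} = span_e_nonzero M s"
  proof (intro set_eqI iffI)
    fix p :: "'a list" assume "p \<in> {p. proj_image_apex n H p}"
    then have p: "proj_image_apex n H p" by simp
    then obtain \<phi> where \<phi>: "functional \<phi>" "\<forall>i<M. \<phi> (?v i) = emb (mconst (p ! i))"
      using proj_image_apex_functional[OF p V] HM by auto
    have "p ! i = 0" if "s \<le> i" "i < M" for i
      using zero[OF derivation_functional_grad[OF \<phi>(1)] _ that] \<phi>(2) that by (auto simp: emb_eq_0_iff)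
    then show "p \<in> span_e_nonzero M s"
      using p HM by (simp add: span_e_nonzero_def proj_image_apex_def)
  next
    fix p :: "'a list" assume p: "p \<in> span_e_nonzero M s"
    obtain \<phi> where \<phi>: "functional \<phi>" "\<forall>i<s. \<phi> (?v i) = emb (mconst (p ! i))" "\<forall>i. s \<le> i \<longrightarrow> i < M \<longrightarrow> \<phi> (?v i) = 0"
      using extend[of "(!) p"] by blast
    have "\<phi> (?v i) = emb (mconst (p ! i))" if "i < length H" for i
      using \<phi>(2,3) p that HM by (cases "i < s") (auto simp: span_e_nonzero_def)
    then show "p \<in> {p. proj_image_apex n H p}"
      using p HM proj_image_apexI[OF derivation_functional_grad[OF \<phi>(1)] _ V, where p = p]
      by (auto simp: span_e_nonzero_def)
  qed

  have lenh: "length h = M - 1" using sk kM HM by (simp add: h_def)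
  have h: "h ! i = (if i = s then H ! s + H ! (M - 1) else H ! i)" if "i < M - 1" for i
    using that sk kM HM by (auto simp: h_def nth_append nth_Cons' min_def)
  have Vh: "vars (h ! i) \<subseteq> {..<n}" if "i < length h" for i
    using that V[of s] V[of "M - 1"] V[of i] vars_add[of "H ! s" "H ! (M - 1)"] HM sk kM
    by (auto simp: lenh h)
  have sM: "s < M - 1" using sk kM by linarith
  have hs: "h ! s = H ! s + H ! (M - 1)" using sk kM by (simp add: h)
  have grad_hs: "grad (emb (h ! s)) = ?v s + ?v (M - 1)"
    unfolding hs emb_add grad_add ..
  have Sh: "S \<subseteq> {..<M - 1}" "\<And>i. i < M - 1 \<Longrightarrow> i \<noteq> s \<Longrightarrow> i \<in> S" by (auto simp: S_def)
  have hS: "h ! i = H ! i" if "i \<in> S" for i using that Sh h[of i] by (auto simp: S_def)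

  \<comment> \<open>Only the sum of the values at \<open>s\<close> and \<open>M - 1\<close> is known
    to be constant. Once the value at \<open>s\<close> is constant by itself, so is the other, and
    \<open>zero\<close> applies.\<close>
  have zero_h: "D (emb (H ! i)) = 0"
    if D: "derivation D" and const: "\<And>i. i < M - 1 \<Longrightarrow> \<exists>c. D (emb (h ! i)) = emb (mconst c)" and i: "s \<le> i" "i < M" for D i
  proof -
    have constS: "\<exists>c. D (emb (H ! i)) = emb (mconst c)" if "i \<in> S" for i
      using const[of i] that Sh(1) hS[OF that] by auto
    obtain c where "D (emb (h ! s)) = emb (mconst c)" using const[of s] sM by blast
    then have sum: "D (emb (H ! s)) + D (emb (H ! (M - 1))) = emb (mconst c)"
      unfolding hs emb_add derivation_add[OF D] .
    let ?A = "{s+1..<k}"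
    have "\<exists>c. D (emb (H ! s)) = emb (mconst c)"
    proof (cases "s < l")
      case True
      then have B: "{l..<M - 1} \<subseteq> S" by (auto simp: S_def)
      show ?thesis
      proof (rule derivation_const_of_sum_const[OF liS finS A B span_s span_M D constS sum])
        show "?A \<inter> {l..<M - 1} = {} \<or> (\<exists>j \<phi> a b. ?A \<inter> {l..<M - 1} = {j} \<and> functional \<phi> \<and>
          (\<forall>i\<in>?A. \<phi> (?v i) = emb (mconst (a i)) - emb (H ! i)) \<and> \<phi> (?v s) = emb (mconst b) - emb (H ! s))"
        proof (cases "l = k")
          case False
          then have "l = k - 1" and "\<exists>a. image_apex n H a" using alt by (auto simp: l_def split: if_splits)
          then obtain a where a: "image_apex n H a" by blast
          obtain \<phi> where "functional \<phi>" "\<forall>i<length H. \<phi> (?v i) = emb (mconst (a ! i)) - emb (H ! i)"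
            using image_apex_functional[OF a V] by blast
          \<comment> \<open>The overlap is the index of the component \<open>H_k\<close>; it differs
            from \<open>s\<close> because \<open>s < l\<close>.\<close>
          moreover have "?A \<inter> {l..<M - 1} = {k - 1}" using \<open>l = k - 1\<close> True kM by auto
          ultimately show ?thesis
            using sk kM HM by (intro disjI2 exI[of _ "k - 1"] exI[of _ \<phi>] exI[of _ "(!) a"] exI[of _ "a ! s"]) auto
        qed auto
      qed
    next
      case False
      \<comment> \<open>Here \<open>k = s + 1\<close>, so the first block is a single component with
        zero gradient. Since the second block meets \<open>s\<close>, all of \<open>S\<close> takes
        its place as spanning set.\<close>
      then have "?A = {}" using l by auto
      then show ?thesis
        using derivation_const_of_sum_const[OF liS finS A subset_refl span_s span_MS D constS sum] by auto
    qed
    then obtain c' where c': "D (emb (H ! s)) = emb (mconst c')" by blast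
    with sum have "D (emb (H ! (M - 1))) = emb (mconst c) - emb (mconst c')" by (simp only: eq_diff_eq add.commute)
    then have cM: "D (emb (H ! (M - 1))) = emb (mconst (c - c'))" by (simp add: mconst_diff)
    have "\<exists>c. D (emb (H ! i)) = emb (mconst c)" if "i < M" for i
      using that c' cM constS[of i] by (cases "i \<in> S") (auto simp: S_def)
    then show ?thesis using zero[OF D _ i] by blast
  qed

  have apexh: "{q. proj_image_apex n h q} = span_e_nonzero (M - 1) s"
  proof (intro set_eqI iffI)
    fix q :: "'a list" assume "q \<in> {q. proj_image_apex n h q}"
    then have q: "proj_image_apex n h q" by simp
    then obtain \<phi> where \<phi>: "functional \<phi>" "\<forall>i<M - 1. \<phi> (grad (emb (h ! i))) = emb (mconst (q ! i))"
      using proj_image_apex_functional[OF q Vh] lenh by auto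
    then have z: "\<phi> (?v i) = 0" if "s \<le> i" "i < M" for i
      using zero_h[OF derivation_functional_grad[OF \<phi>(1)] _ that] by blast
    have "q ! i = 0" if i: "s \<le> i" "i < M - 1" for i
    proof -
      have "\<phi> (grad (emb (h ! i))) = 0"
        using z[of i] z[of s] z[of "M - 1"] i grad_hs gv.linear_add[OF \<phi>(1)] h[OF i(2)] by (cases "i = s") auto
      then show ?thesis using \<phi>(2) i by (simp add: emb_eq_0_iff)
    qed
    then show "q \<in> span_e_nonzero (M - 1) s"
      using q lenh by (simp add: span_e_nonzero_def proj_image_apex_def)
  next
    fix q :: "'a list" assume q: "q \<in> span_e_nonzero (M - 1) s"
    obtain \<phi> where \<phi>: "functional \<phi>" "\<forall>i<s. \<phi> (?v i) = emb (mconst (q ! i))" "\<forall>i. s \<le> i \<longrightarrow> i < M \<longrightarrow> \<phi> (?v i) = 0"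
      using extend[of "(!) q"] by blast
    have "\<phi> (grad (emb (h ! i))) = emb (mconst (q ! i))" if i: "i < length h" for i
    proof (cases "i = s")
      case True
      then show ?thesis
        using \<phi>(3) q i sk kM lenh grad_hs gv.linear_add[OF \<phi>(1)] by (auto simp: span_e_nonzero_def)
    next
      case False
      then show ?thesis
        using \<phi>(2,3) q i lenh h[of i] by (cases "i < s") (auto simp: span_e_nonzero_def)
    qed
    then show "q \<in> {q. proj_image_apex n h q}"
      using q lenh proj_image_apexI[OF derivation_functional_grad[OF \<phi>(1)] _ Vh, where p = q]
      by (auto simp: span_e_nonzero_def)
  qed

  \<comment> \<open>\<open>S\<close> is also a basis for \<open>h\<close>: the tuples agree on
    \<open>S\<close>, and the merged component has a gradient in the span.\<close>
  have trh: "trdeg h = trdeg H"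
  proof -
    have li: "lindep ((!) h) S" using liS lindep_cong[of S "(!) h" ?g] hS by simp
    have eq: "gspan ((!) h) S = gspan ?g S"
      by (rule arg_cong[where f = "gv.vs1.span"], rule image_cong) (simp_all add: hS)
    have "grad (emb (h ! i)) \<in> gspan ((!) h) S" if "i < length h" for i
      using that spanS[of i] spanS[of s] spanS[of "M - 1"] grad_hs h[of i] sk kM gv.vs1.span_add[of "?v s" "?v ` S" "?v (M - 1)"]
      unfolding eq by (cases "i = s") (auto simp: lenh)
    then have "trdeg h = card S"
      using trdeg_eq_card_basis[OF Vh _ li] Sh(1) lenh by auto
    then show ?thesis using tr cardS by simp
  qed

  define B :: "nat \<Rightarrow> nat \<Rightarrow> 'a" where "B i j = (if j = i \<or> i = s \<and> j = M - 1 then 1 else 0)" for i j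
  have "dB_paired n h H B id_mat"
    unfolding dB_paired_def
  proof (intro conjI allI impI trh)
    fix i assume i: "i < length h"
    have "(\<Sum>r<n. mconst (id_mat l r) * mvar r) = (mvar l :: 'a mpoly)" if "l < n" for l
    proof -
      have "(\<Sum>r<n. mconst (id_mat l r) * mvar r) = (\<Sum>r<n. if r = l then mvar l else 0 :: 'a mpoly)"
        by (intro sum.cong) (auto simp: id_mat_def)
      then show ?thesis using that by simp
    qed
    then have "(\<lambda>l. if l < n then (\<Sum>r<n. mconst (id_mat l r) * mvar r) else mvar l) = (mvar :: nat \<Rightarrow> 'a mpoly)"
      by (auto simp: fun_eq_iff)
    moreover have "h ! i = (\<Sum>j<M. mconst (B i j) * H ! j)"
    proof -
      have "(\<Sum>j<M. mconst (B i j) * H ! j) = (\<Sum>j\<in>(if i = s then {s, M - 1} else {i}). H ! j)"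
        using i lenh sk kM by (intro sum.mono_neutral_cong_right) (auto simp: B_def split: if_splits)
      then show ?thesis using i lenh sk kM h[of i] by auto
    qed
    ultimately show "h ! i = (\<Sum>j<length H. mconst (B i j) *
        subst (\<lambda>l. if l < n then (\<Sum>r<n. mconst (id_mat l r) * mvar r) else mvar l) (H ! j))"
      using HM by simp
  qed
  \<comment> \<open>The witness is \<open>q\<close> with a zero appended: an apex of
    \<open>H\<close> vanishes from index \<open>s\<close> on, so its last entry adds nothing in row
    \<open>s\<close> of \<open>B\<close>.\<close>
  moreover have "\<exists>Q. proj_image_apex n H Q \<and> q = mat_vec (M - 1) B Q" if "proj_image_apex n h q" for q
  proof -
    have q: "q \<in> span_e_nonzero (M - 1) s" using that apexh by blast
    then have len: "length q = M - 1" by (simp add: span_e_nonzero_def)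
    have nz: "q @ [0] \<noteq> replicate M 0"
    proof -
      have "replicate M 0 = replicate (M - 1) 0 @ [0 :: 'a]"
        using kM replicate_append_same[of "M - 1" "0 :: 'a"] by (cases M) simp_all
      then show ?thesis using q by (simp add: span_e_nonzero_def)
    qed
    have "q @ [0] \<in> span_e_nonzero M s"
      using q nz sk kM by (auto simp: span_e_nonzero_def nth_append)
    then have "proj_image_apex n H (q @ [0])" using apexH by blast
    moreover have "q = mat_vec (M - 1) B (q @ [0])"
    proof (rule nth_equalityI)
      show "length q = length (mat_vec (M - 1) B (q @ [0]))" by (simp add: mat_vec_def len)
      fix i assume i: "i < length q"
      have "(\<Sum>j<M. B i j * (q @ [0]) ! j) = (\<Sum>j\<in>{i}. q ! j)"
        using i len by (intro sum.mono_neutral_cong_right) (auto simp: B_def nth_append)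
      then show "q ! i = mat_vec (M - 1) B (q @ [0]) ! i"
        using i len kM by (simp add: mat_vec_def)
    qed
    ultimately show ?thesis by blast
  qed
  ultimately show ?thesis using apexH apexh by blast
qed

end
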